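(* For each $w\in\mathfrak{W}_r$ there exists a representative $\Omega(w)\in L_r$ of $w$ (namely $\Omega(w_{i,i+1})=\omega(w_{i,i+1})$, $\Omega(w_1)=\begin{pmatrix}0&0&\varpi_E^{-1}&0\\0&1_{r-1}&0&0\\\varpi_E&0&0&0\\0&0&0&1_{r-1}\end{pmatrix}$, extended multiplicatively) such that $$G_r=\bigsqcup_{w\in\mathfrak{W}_r}P_r\,\Omega(w)\,I_r=P_rL_r,$$ and moreover $P_r\cap L_r=(T\cap L_r)(N_r\cap L_r)$.
   Context: $p$ odd; $E/F$ ramified quadratic extension of $p$-adic fields, $x\mapsto\bar x$ the Galois involution, $\varpi_E$ a uniformizer with $\varpi_E^2\in F$. $W_r=\bigoplus_{i=1}^{2r}Ee_i$ with skew-Hermitian form of matrix $\begin{pmatrix}0&1_r\\-1_r&0\end{pmatrix}$, $G_r=\mathrm{U}(W_r)(F)$, $T$ the diagonal torus, $P_r$ the Borel subgroup of elements $\begin{pmatrix}a&b\\0&{}^t\bar a^{-1}\end{pmatrix}$ with $a$ lower triangular, $N_r$ its unipotent radical. $K_r$ is the stabilizer of $\bigoplus_{i=1}^{2r}\mathcal{O}_Ee_i$ and $I_r\subset K_r$ the Iwahori subgroup attached to $P_r$. $L_r$ is the stabilizer in $G_r$ of the lattice $\Lambda'_r=\bigoplus_{i=1}^r\mathcal{O}_Ee_i\oplus\bigoplus_{i=r+1}^{2r}\varpi_E\mathcal{O}_Ee_i$. The Weyl group $\mathfrak{W}_r=\{\pm1\}^r\rtimes S_r$ of $T$ is generated by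 $w_1$ (sign change of the first coordinate) and transpositions $w_{i,i+1}$, with representatives $\omega(w_1)=\begin{pmatrix}0&0&1&0\\0&1_{r-1}&0&0\\-1&0&0&0\\0&0&0&1_{r-1}\end{pmatrix}$ (blocks $1,r-1,1,r-1$) and $\omega(w_{i,i+1})$ the permutation matrix swapping $e_i\leftrightarrow e_{i+1}$ and $e_{r+i}\leftrightarrow e_{r+i+1}$. *)

theory Defs
  imports
    "Jordan_Normal_Form.Matrix"
    "HOL-Algebra.Group_Action"
    "HOL-Computational_Algebra.Primes"
begin

section \<open>p-adic fields\<close>

text \<open>A discrete valuation on a field is given by its values on the nonzero elements; the value at
  \<open>0\<close> is irrelevant. It is normalized to be onto the integers.\<close>

definition discrete_valuation :: "('a::field \<Rightarrow> int) \<Rightarrow> bool" where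
  "discrete_valuation v \<longleftrightarrow>
     (\<forall>x y. x \<noteq> 0 \<longrightarrow> y \<noteq> 0 \<longrightarrow> v (x * y) = v x + v y) \<and>
     (\<forall>x y. x \<noteq> 0 \<longrightarrow> y \<noteq> 0 \<longrightarrow> x + y \<noteq> 0 \<longrightarrow> min (v x) (v y) \<le> v (x + y)) \<and>
     v ` (- {0}) = UNIV"

text \<open>The fractional ideal of elements of valuation at least \<open>N\<close>.\<close>

definition val_ge :: "('a::field \<Rightarrow> int) \<Rightarrow> int \<Rightarrow> 'a set" where
  "val_ge v N = {x. x = 0 \<or> N \<le> v x}"

abbreviation val_ring :: "('a::field \<Rightarrow> int) \<Rightarrow> 'a set" where
  "val_ring v \<equiv> val_ge v 0"

abbreviation max_ideal :: "('a::field \<Rightarrow> int) \<Rightarrow> 'a set" where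
  "max_ideal v \<equiv> val_ge v 1"

definition valuation_complete :: "('a::field \<Rightarrow> int) \<Rightarrow> bool" where
  "valuation_complete v \<longleftrightarrow>
     (\<forall>X :: nat \<Rightarrow> 'a.
        (\<forall>N. \<exists>n0. \<forall>m\<ge>n0. \<forall>n\<ge>n0. X m - X n \<in> val_ge v N) \<longrightarrow>
        (\<exists>x. \<forall>N. \<exists>n0. \<forall>n\<ge>n0. X n - x \<in> val_ge v N))"

text \<open>A \<open>p\<close>-adic field is a nonarchimedean local field of characteristic zero with residue
  characteristic \<open>p\<close>; the characteristic is imposed by the type class.\<close>

definition padic_field :: "nat \<Rightarrow> ('a::field_char_0 \<Rightarrow> int) \<Rightarrow> bool" where
  "padic_field p v \<longleftrightarrow>
     discrete_valuation v \<and> valuation_complete v \<and>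
     finite (val_ring v // {(x, y). x \<in> val_ring v \<and> y \<in> val_ring v \<and> x - y \<in> max_ideal v}) \<and>
     prime p \<and> of_nat p \<in> max_ideal v"

text \<open>The extension \<open>E/F\<close> is an embedding \<open>\<iota>\<close> of \<open>F\<close> into \<open>E\<close>.\<close>

definition quadratic_extension :: "('f::field \<Rightarrow> 'e::field) \<Rightarrow> bool" where
  "quadratic_extension \<iota> \<longleftrightarrow>
     field_hom \<iota> \<and> vector_space.dim (\<lambda>a x. \<iota> a * x) (UNIV :: 'e set) = 2"

definition ramification_index ::
  "('f::field \<Rightarrow> 'e::field) \<Rightarrow> ('f \<Rightarrow> int) \<Rightarrow> ('e \<Rightarrow> int) \<Rightarrow> nat \<Rightarrow> bool" where
  "ramification_index \<iota> vF vE e \<longleftrightarrow> (\<forall>x. x \<noteq> 0 \<longrightarrow> vE (\<iota> x) = int e * vF x)"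

definition ramified_extension ::
  "('f::field \<Rightarrow> 'e::field) \<Rightarrow> ('f \<Rightarrow> int) \<Rightarrow> ('e \<Rightarrow> int) \<Rightarrow> bool" where
  "ramified_extension \<iota> vF vE \<longleftrightarrow> (\<exists>e>1. ramification_index \<iota> vF vE e)"

text \<open>For a quadratic extension this is the nontrivial element of the Galois group.\<close>

definition galois_involution :: "('f::field \<Rightarrow> 'e::field) \<Rightarrow> ('e \<Rightarrow> 'e) \<Rightarrow> bool" where
  "galois_involution \<iota> bar \<longleftrightarrow>
     field_hom bar \<and> bij bar \<and> (\<forall>a. bar (\<iota> a) = \<iota> a) \<and> bar \<noteq> id"


section \<open>The unitary group and its subgroups\<close>

text \<open>Matrices act on column vectors. Indices start at \<open>0\<close>: the basis vector \<open>e\<^sub>i\<close> of \<open>W\<^sub>r\<close> has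
  index \<open>i - 1\<close>. The conjugation of \<open>E\<close> is a parameter \<open>bar\<close> throughout.\<close>

definition skew_form_mat :: "nat \<Rightarrow> 'e::field mat" where
  "skew_form_mat r = four_block_mat (0\<^sub>m r r) (1\<^sub>m r) (- 1\<^sub>m r) (0\<^sub>m r r)"

definition skew_herm_form :: "nat \<Rightarrow> ('e::field \<Rightarrow> 'e) \<Rightarrow> 'e vec \<Rightarrow> 'e vec \<Rightarrow> 'e" where
  "skew_herm_form r bar x y = x \<bullet> (skew_form_mat r *\<^sub>v map_vec bar y)"

definition unitary_group :: "nat \<Rightarrow> ('e::field \<Rightarrow> 'e) \<Rightarrow> 'e mat monoid" where
  "unitary_group r bar =
     \<lparr>carrier = {g \<in> carrier_mat (2*r) (2*r). invertible_mat g \<and>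
        (\<forall>x \<in> carrier_vec (2*r). \<forall>y \<in> carrier_vec (2*r).
           skew_herm_form r bar (g *\<^sub>v x) (g *\<^sub>v y) = skew_herm_form r bar x y)},
      mult = (*), one = 1\<^sub>m (2*r)\<rparr>"

definition diag_torus :: "nat \<Rightarrow> ('e::field \<Rightarrow> 'e) \<Rightarrow> 'e mat set" where
  "diag_torus r bar = {g \<in> carrier (unitary_group r bar). diagonal_mat g}"

definition borel_subgroup :: "nat \<Rightarrow> ('e::field \<Rightarrow> 'e) \<Rightarrow> 'e mat set" where
  "borel_subgroup r bar =
     {g \<in> carrier (unitary_group r bar).
        \<exists>a b a'. a \<in> carrier_mat r r \<and> b \<in> carrier_mat r r \<and> a' \<in> carrier_mat r r \<and>
          (\<forall>i j. i < j \<longrightarrow> j < r \<longrightarrow> a $$ (i, j) = 0) \<and>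
          inverts_mat (map_mat bar a) a' \<and> inverts_mat a' (map_mat bar a) \<and>
          g = four_block_mat a b (0\<^sub>m r r) (transpose_mat a')}"

definition unipotent_mat :: "'e::field mat \<Rightarrow> bool" where
  "unipotent_mat g \<longleftrightarrow>
     square_mat g \<and> (\<exists>k. (g - 1\<^sub>m (dim_row g)) ^\<^sub>m k = 0\<^sub>m (dim_row g) (dim_row g))"

text \<open>The unipotent radical of \<open>H \<le> G\<close> as the largest normal subgroup of \<open>H\<close> consisting of
  unipotent elements. Connectedness need not be imposed, because unipotent groups are connected in
  characteristic zero.\<close>

definition unipotent_radical :: "'e::field mat monoid \<Rightarrow> 'e mat set \<Rightarrow> 'e mat set" where
  "unipotent_radical G H = \<Union> {U. U \<lhd> (G\<lparr>carrier := H\<rparr>) \<and> (\<forall>u\<in>U. unipotent_mat u)}"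

abbreviation borel_unipotent :: "nat \<Rightarrow> ('e::field \<Rightarrow> 'e) \<Rightarrow> 'e mat set" where
  "borel_unipotent r bar \<equiv> unipotent_radical (unitary_group r bar) (borel_subgroup r bar)"

definition lattice_stabilizer :: "'e::field mat monoid \<Rightarrow> 'e vec set \<Rightarrow> 'e mat set" where
  "lattice_stabilizer G \<Lambda> = {g \<in> carrier G. (\<lambda>v. g *\<^sub>v v) ` \<Lambda> = \<Lambda>}"

definition std_lattice :: "nat \<Rightarrow> ('e::field \<Rightarrow> int) \<Rightarrow> 'e vec set" where
  "std_lattice r vE = {v \<in> carrier_vec (2*r). \<forall>i < 2*r. v $ i \<in> val_ring vE}"

definition lattice' :: "nat \<Rightarrow> ('e::field \<Rightarrow> int) \<Rightarrow> 'e \<Rightarrow> 'e vec set" where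
  "lattice' r vE \<pi> = {v \<in> carrier_vec (2*r).
     (\<forall>i < r. v $ i \<in> val_ring vE) \<and> (\<forall>i \<in> {r..<2*r}. v $ i \<in> (\<lambda>x. \<pi> * x) ` val_ring vE)}"

definition K_group :: "nat \<Rightarrow> ('e::field \<Rightarrow> 'e) \<Rightarrow> ('e \<Rightarrow> int) \<Rightarrow> 'e mat set" where
  "K_group r bar vE = lattice_stabilizer (unitary_group r bar) (std_lattice r vE)"

definition L_group :: "nat \<Rightarrow> ('e::field \<Rightarrow> 'e) \<Rightarrow> ('e \<Rightarrow> int) \<Rightarrow> 'e \<Rightarrow> 'e mat set" where
  "L_group r bar vE \<pi> = lattice_stabilizer (unitary_group r bar) (lattice' r vE \<pi>)"

text \<open>The Iwahori subgroup is the preimage in \<open>K\<^sub>r\<close> of the Borel subgroup of the same shape as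
  \<open>P\<^sub>r\<close> in the reduction of \<open>K\<^sub>r\<close> modulo the maximal ideal. As \<open>E/F\<close> is ramified, that reduction is
  contained in the symplectic group of the form matrix over the residue field. So it is enough to
  require that the lower left block vanishes and that the upper left block is lower triangular; the
  lower right block is then determined.\<close>

definition iwahori :: "nat \<Rightarrow> ('e::field \<Rightarrow> 'e) \<Rightarrow> ('e \<Rightarrow> int) \<Rightarrow> 'e mat set" where
  "iwahori r bar vE =
     {g \<in> K_group r bar vE.
        (\<forall>i \<in> {r..<2*r}. \<forall>j < r. g $$ (i, j) \<in> max_ideal vE) \<and>
        (\<forall>i j. i < j \<longrightarrow> j < r \<longrightarrow> g $$ (i, j) \<in> max_ideal vE)}"


section \<open>The Weyl group\<close>

text \<open>The Weyl group of \<open>T\<close> is the quotient \<open>N(T)/T\<close>. Its elements are cosets of \<open>T\<close>, and a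
  representative of \<open>w\<close> is an element of the set \<open>w\<close>.\<close>

definition weyl_group :: "nat \<Rightarrow> ('e::field \<Rightarrow> 'e) \<Rightarrow> 'e mat set monoid" where
  "weyl_group r bar =
     (let G = unitary_group r bar; T = diag_torus r bar
      in G\<lparr>carrier := normalizer G T\<rparr> Mod T)"

definition weyl_class :: "nat \<Rightarrow> ('e::field \<Rightarrow> 'e) \<Rightarrow> 'e mat \<Rightarrow> 'e mat set" where
  "weyl_class r bar g = diag_torus r bar #>\<^bsub>unitary_group r bar\<^esub> g"

definition omega_sign :: "nat \<Rightarrow> 'e::field mat" where
  "omega_sign r = mat (2*r) (2*r) (\<lambda>(i, j).
     if (i, j) = (0, r) then 1 else if (i, j) = (r, 0) then - 1
     else if i = j \<and> i \<noteq> 0 \<and> i \<noteq> r then 1 else 0)"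

definition Omega_sign :: "nat \<Rightarrow> 'e \<Rightarrow> 'e::field mat" where
  "Omega_sign r \<pi> = mat (2*r) (2*r) (\<lambda>(i, j).
     if (i, j) = (0, r) then inverse \<pi> else if (i, j) = (r, 0) then \<pi>
     else if i = j \<and> i \<noteq> 0 \<and> i \<noteq> r then 1 else 0)"

text \<open>For \<open>1 \<le> i < r\<close> (counting from \<open>1\<close>), \<open>omega_swap r i\<close> interchanges \<open>e\<^sub>i\<close> with the next basis
  vector, and \<open>e\<close> with index \<open>r + i\<close> with its successor.\<close>

definition omega_swap :: "nat \<Rightarrow> nat \<Rightarrow> 'e::field mat" where
  "omega_swap r i = mat (2*r) (2*r) (\<lambda>(k, l).
     if k = (transpose (i - 1) i \<circ> transpose (r + i - 1) (r + i)) l then 1 else 0)"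

end

theory Submission
  imports Defs "Jordan_Normal_Form.Determinant"
begin

text \<open>
  The inverse of a unitary matrix \<open>g\<close> is, up to signs, its conjugate transpose with the indices
  permuted by \<open>e\<^sub>i \<leftrightarrow> e\<^bsub>r+i\<^esub>\<close>. Hence in the stabilizer of a lattice that is self-dual up to scaling,
  integrality of the inverse is automatic, and \<open>P\<^sub>r\<close> and \<open>I\<^sub>r\<close> are the unitary
  matrices that are upper triangular modulo the prime ideal \<open>0\<close> of \<open>E\<close> and the maximal ideal of
  its ring of integers, respectively, for the order of the basis \<open>e\<^sub>r, \<dots>, e\<^sub>1, e\<^bsub>r+1\<^esub>, \<dots>, e\<^bsub>2r\<^esub>\<close>.

  The matrices \<open>\<Omega>(w)\<close> are \<open>D S D\<^bsup>-1\<^esup>\<close> with \<open>D = diag(1, \<dots>, 1, \<varpi>, \<dots>, \<varpi>)\<close> and \<open>S\<close> a permutation matrix, so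
  they are multiplicative and lie in \<open>L\<^sub>r\<close>; they are unitary because the involution sends \<open>\<varpi>\<close> to
  \<open>- \<varpi>\<close>. A torus element with entries of distinct valuations shows that its normalizer consists of
  monomial matrices.

  To decompose \<open>g\<close>, reduce its first \<open>r\<close> columns in turn by Eichler transformations. The pivot is
  an entry of least valuation and, among these, of largest rank; this choice puts the transformation
  into \<open>I\<^sub>r\<close>. The cells are disjoint because \<open>p \<Omega>(\<sigma>) = \<Omega>(\<tau>) k\<close> with \<open>k\<close> having nonzero diagonal forces
  \<open>rank (\<tau> j) \<le> rank (\<sigma> j)\<close> for all \<open>j\<close>, and both sides have the same sum.
\<close>

section \<open>Coordinates for the skew-Hermitian form and its isometry group\<close>

section \<open>The unitary group in coordinates\<close>

declare index_mult_mat(1) [simp del]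

text \<open>Entries of products appear throughout as sums over \<open>{..<k}\<close>. The simp rule
  that would turn them into scalar products of rows and columns has just been removed.\<close>

lemma mat_mult_entry:
  "A \<in> carrier_mat m k \<Longrightarrow> B \<in> carrier_mat k l \<Longrightarrow> i < m \<Longrightarrow> j < l \<Longrightarrow>
    (A * B) $$ (i, j) = (\<Sum>t<k. A $$ (i, t) * B $$ (t, j))"
  by (auto simp: index_mult_mat(1) scalar_prod_def lessThan_atLeast0 intro!: sum.cong)

text \<open>Pairs the two isotropic halves: \<open>star r i\<close> is the index of the basis vector
  dual to \<open>e_i\<close> up to sign.\<close>

definition star :: "nat \<Rightarrow> nat \<Rightarrow> nat" where
  "star r i = (if i < r then i + r else i - r)"

text \<open>Ordering the basis by \<open>rank\<close> makes \<open>P\<^sub>r\<close> upper triangular and the form antidiagonal.\<close>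

definition rank :: "nat \<Rightarrow> nat \<Rightarrow> nat" where
  "rank r i = (if i < r then r - 1 - i else i)"

text \<open>Signs of the form matrix: its row \<open>i\<close> has the single nonzero entry
  \<open>eps r i\<close>, in column \<open>star r i\<close>.\<close>

definition eps :: "nat \<Rightarrow> nat \<Rightarrow> 'e::field" where
  "eps r i = (if i < r then 1 else - 1)"

lemma eps_sq [simp]: "eps r i * eps r i = 1" "eps r i * (eps r i * x) = x"
  by (auto simp: eps_def)

lemma eps_nonzero [simp]: "eps r i \<noteq> 0"
  by (auto simp: eps_def)

text \<open>The dimension \<open>n\<close> is a parameter of its own because the simplifier rearranges \<open>2 * r\<close>.\<close>

locale unitary_space = field_hom bar for bar :: "'e::field \<Rightarrow> 'e" +
  fixes r n :: nat
  assumes bar_bar [simp]: "bar (bar x) = x"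
    and dim: "n = 2 * r"
begin

lemma two_r: "2 * r = n" by (simp add: dim)

lemma star_less [simp]: "i < n \<Longrightarrow> star r i < n"
  and star_star [simp]: "i < n \<Longrightarrow> star r (star r i) = i"
  and star_neq: "i < n \<Longrightarrow> star r i \<noteq> i"
  using dim by (auto simp: star_def)

lemma star_eq_iff: "i < n \<Longrightarrow> j < n \<Longrightarrow> star r i = star r j \<longleftrightarrow> i = j"
  and star_swap: "i < n \<Longrightarrow> j < n \<Longrightarrow> star r i = j \<longleftrightarrow> i = star r j"
  using dim by (auto simp: star_def)

lemma bij_star: "bij_betw (star r) {..<n} {..<n}"
  by (rule bij_betwI[where g = "star r"]) auto

lemma rank_less: "i < n \<Longrightarrow> rank r i < n"
  and rank_star: "i < n \<Longrightarrow> rank r (star r i) = n - 1 - rank r i"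
  and rank_inj: "i < n \<Longrightarrow> j < n \<Longrightarrow> rank r i = rank r j \<Longrightarrow> i = j"
  using dim by (auto simp: rank_def star_def split: if_splits)

text \<open>Since \<open>star\<close> reverses the order by rank, transposing a matrix and applying
  \<open>star\<close> to both indices preserves triangularity in that order.\<close>

lemma rank_star_less_iff:
  assumes "i < n" "j < n"
  shows "rank r (star r i) < rank r (star r j) \<longleftrightarrow> rank r j < rank r i"
  using dim rank_less[OF assms(1)] rank_less[OF assms(2)] assms by (auto simp: rank_star)

lemma eps_star: "i < n \<Longrightarrow> eps r (star r i) = - eps r i"
  using dim by (auto simp: eps_def star_def)

lemma sum_star: "(\<Sum>i<n. f (star r i)) = (\<Sum>i<n. f i)"
  using sum.reindex_bij_betw[OF bij_star] by auto


lemma bar_eps [simp]: "bar (eps r i) = eps r i"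
  by (auto simp: eps_def hom_distribs)

text \<open>The skew-Hermitian form on coordinate functions, so that columns of matrices can be
  paired without forming vectors.\<close>

definition form :: "(nat \<Rightarrow> 'e) \<Rightarrow> (nat \<Rightarrow> 'e) \<Rightarrow> 'e" where
  "form x y = (\<Sum>l<n. eps r l * x l * bar (y (star r l)))"

text \<open>The Gram matrix of the standard basis.\<close>

definition gram :: "nat \<Rightarrow> nat \<Rightarrow> 'e" where
  "gram i j = (if j = star r i then eps r i else 0)"

text \<open>The adjoint with respect to the form. It gives the inverse of a unitary matrix entry by
  entry.\<close>

definition adj :: "'e mat \<Rightarrow> 'e mat" where
  "adj g = mat n n (\<lambda>(i, j). eps r i * eps r j * bar (g $$ (star r j, star r i)))"

lemma adj_carrier [simp]: "adj g \<in> carrier_mat n n"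
  and dim_adj [simp]: "dim_row (adj g) = n" "dim_col (adj g) = n"
  by (auto simp: adj_def)

lemma adj_index:
  "i < n \<Longrightarrow> j < n \<Longrightarrow> adj g $$ (i, j) = eps r i * eps r j * bar (g $$ (star r j, star r i))"
  by (auto simp: adj_def)

lemma adj_adj:
  assumes "g \<in> carrier_mat n n" shows "adj (adj g) = g"
  using assms by (intro eq_matI) (auto simp: adj_index eps_star hom_distribs algebra_simps)

lemma adj_mult:
  assumes g: "g \<in> carrier_mat n n" and h: "h \<in> carrier_mat n n"
  shows "adj (g * h) = adj h * adj g"
proof (rule eq_matI)
  fix i j assume "i < dim_row (adj h * adj g)" "j < dim_col (adj h * adj g)"
  hence i: "i < n" and j: "j < n" by auto
  have "adj (g * h) $$ (i, j)
      = eps r i * eps r j * (\<Sum>l<n. bar (g $$ (star r j, l)) * bar (h $$ (l, star r i)))"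
    using i j by (simp add: adj_index mat_mult_entry[OF g h] hom_sum hom_mult)
  also have "\<dots> = eps r i * eps r j * (\<Sum>l<n. bar (g $$ (star r j, star r l)) * bar (h $$ (star r l, star r i)))"
    by (subst sum_star[symmetric]) simp
  also have "\<dots> = (\<Sum>l<n. adj h $$ (i, l) * adj g $$ (l, j))"
    using i j by (simp add: adj_index sum_distrib_left algebra_simps)
  also have "\<dots> = (adj h * adj g) $$ (i, j)"
    using i j by (simp add: mat_mult_entry[OF adj_carrier adj_carrier])
  finally show "adj (g * h) $$ (i, j) = (adj h * adj g) $$ (i, j)" .
qed auto

lemma adj_mult_index:
  assumes "g \<in> carrier_mat n n" "i < n" "j < n"
  shows "(adj g * g) $$ (i, j) = eps r i * form (\<lambda>l. g $$ (l, j)) (\<lambda>l. g $$ (l, star r i))"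
  using assms
  by (simp add: mat_mult_entry[OF adj_carrier assms(1)] adj_index form_def sum_distrib_left algebra_simps)

text \<open>By \<open>adj_mult_index\<close> the entries of \<open>adj g * g\<close> are, up to
  sign, the pairings of columns of \<open>g\<close>, with one index moved by \<open>star\<close>. So
  the equation says that the columns have the Gram matrix of the standard basis.\<close>

lemma adj_mult_eq_one_iff:
  assumes g: "g \<in> carrier_mat n n"
  shows "adj g * g = 1\<^sub>m n \<longleftrightarrow>
    (\<forall>i<n. \<forall>j<n. form (\<lambda>l. g $$ (l, i)) (\<lambda>l. g $$ (l, j)) = gram i j)" (is "_ \<longleftrightarrow> ?R")
proof
  assume a: "adj g * g = 1\<^sub>m n"
  show ?R
  proof (intro allI impI)
    fix i j assume i: "i < n" and j: "j < n"
    have "eps r (star r j) * form (\<lambda>l. g $$ (l, i)) (\<lambda>l. g $$ (l, j)) = (1\<^sub>m n) $$ (star r j, i)"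
      using adj_mult_index[OF g, of "star r j" i] i j by (simp add: a)
    hence "eps r (star r j) * (eps r (star r j) * form (\<lambda>l. g $$ (l, i)) (\<lambda>l. g $$ (l, j)))
        = eps r (star r j) * (1\<^sub>m n) $$ (star r j, i)" by simp
    thus "form (\<lambda>l. g $$ (l, i)) (\<lambda>l. g $$ (l, j)) = gram i j"
      using i j by (auto simp: gram_def star_swap)
  qed
next
  assume R: ?R
  show "adj g * g = 1\<^sub>m n"
  proof (rule eq_matI)
    fix i j assume "i < dim_row (1\<^sub>m n :: 'e mat)" "j < dim_col (1\<^sub>m n :: 'e mat)"
    hence i: "i < n" and j: "j < n" by auto
    show "(adj g * g) $$ (i, j) = 1\<^sub>m n $$ (i, j)"
      using R i j by (auto simp: adj_mult_index[OF g] gram_def star_eq_iff)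
  qed (use g in auto)
qed

lemma skew_herm_form_eq:
  assumes x: "x \<in> carrier_vec n" and y: "y \<in> carrier_vec n"
  shows "skew_herm_form r bar x y = form (\<lambda>l. x $ l) (\<lambda>l. y $ l)"
proof -
  have "(skew_form_mat r *\<^sub>v map_vec bar y) $ l = eps r l * bar (y $ star r l)" if l: "l < n" for l
  proof -
    have dims: "dim_row (skew_form_mat r :: 'e mat) = n" "dim_col (skew_form_mat r :: 'e mat) = n"
      by (auto simp: skew_form_mat_def dim)
    have e: "skew_form_mat r $$ (l, j) = (if j = star r l then eps r l else 0 :: 'e)" if "j < n" for j
      using that l dim by (auto simp: skew_form_mat_def star_def eps_def)
    have "(skew_form_mat r *\<^sub>v map_vec bar y) $ l
        = (\<Sum>j<n. skew_form_mat r $$ (l, j) * bar (y $ j))"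
      using l y dims by (auto simp: scalar_prod_def lessThan_atLeast0 intro!: sum.cong)
    also have "\<dots> = (\<Sum>j<n. if j = star r l then eps r l * bar (y $ j) else 0)"
      by (intro sum.cong refl) (auto simp: e)
    also have "\<dots> = eps r l * bar (y $ star r l)" using l by simp
    finally show ?thesis .
  qed
  moreover have "dim_vec (skew_form_mat r *\<^sub>v map_vec bar y) = n"
    by (simp add: skew_form_mat_def dim)
  ultimately show ?thesis
    by (auto simp: skew_herm_form_def form_def scalar_prod_def lessThan_atLeast0 algebra_simps
        intro!: sum.cong)
qed

text \<open>Reduces invariance of the form on all vectors to the pairings of the columns.\<close>

lemma form_bilinear:
  "form (\<lambda>l. \<Sum>i<n. G l i * x i) (\<lambda>l. \<Sum>j<n. G l j * y j)
    = (\<Sum>i<n. \<Sum>j<n. x i * bar (y j) * form (\<lambda>l. G l i) (\<lambda>l. G l j))"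
proof -
  have expand: "e * (\<Sum>i<n. a i) * (\<Sum>j<n. b j) = (\<Sum>i<n. \<Sum>j<n. e * a i * b j)"
    for e :: 'e and a b :: "nat \<Rightarrow> 'e"
    by (simp only: sum_distrib_left[of e] sum_product)
  have "form (\<lambda>l. \<Sum>i<n. G l i * x i) (\<lambda>l. \<Sum>j<n. G l j * y j)
      = (\<Sum>l<n. \<Sum>i<n. \<Sum>j<n. eps r l * (G l i * x i) * (bar (G (star r l) j) * bar (y j)))"
    by (simp only: form_def hom_sum hom_mult expand)
  also have "\<dots> = (\<Sum>i<n. \<Sum>j<n. \<Sum>l<n. eps r l * (G l i * x i) * (bar (G (star r l) j) * bar (y j)))"
    by (subst sum.swap, rule sum.cong[OF refl], subst sum.swap, rule refl)
  also have "\<dots> = (\<Sum>i<n. \<Sum>j<n. x i * bar (y j) * form (\<lambda>l. G l i) (\<lambda>l. G l j))"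
    by (simp add: form_def sum_distrib_left algebra_simps)
  finally show ?thesis .
qed

lemma form_cong:
  "(\<And>l. l < n \<Longrightarrow> x l = x' l) \<Longrightarrow> (\<And>l. l < n \<Longrightarrow> y l = y' l) \<Longrightarrow> form x y = form x' y'"
  by (auto simp: form_def intro!: sum.cong)

lemma form_nonzeroD:
  assumes "form x y \<noteq> 0"
  obtains l where "l < n" "x l \<noteq> 0" "y (star r l) \<noteq> 0"
proof -
  have "\<exists>l\<in>{..<n}. eps r l * x l * bar (y (star r l)) \<noteq> 0"
  proof (rule ccontr)
    assume "\<not> ?thesis"
    hence "form x y = 0" unfolding form_def by (intro sum.neutral) auto
    thus False using assms by simp
  qed
  thus thesis using that by auto
qed

text \<open>One direction tests the invariance on unit vectors; the other expands both sides
  sesquilinearly.\<close>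

lemma unitary_iff_form:
  assumes g: "g \<in> carrier_mat n n"
  shows "(\<forall>x \<in> carrier_vec n. \<forall>y \<in> carrier_vec n.
        skew_herm_form r bar (g *\<^sub>v x) (g *\<^sub>v y) = skew_herm_form r bar x y)
    \<longleftrightarrow> (\<forall>i<n. \<forall>j<n. form (\<lambda>l. g $$ (l, i)) (\<lambda>l. g $$ (l, j)) = gram i j)" (is "?L \<longleftrightarrow> ?R")
proof -
  have mv: "(g *\<^sub>v x) $ l = (\<Sum>i<n. g $$ (l, i) * x $ i)" if "x \<in> carrier_vec n" "l < n" for x l
    using that g by (auto simp: scalar_prod_def lessThan_atLeast0 intro!: sum.cong)
  have gx: "g *\<^sub>v x \<in> carrier_vec n" if "x \<in> carrier_vec n" for x using g that by auto
  have form_g: "skew_herm_form r bar (g *\<^sub>v x) (g *\<^sub>v y) =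
      (\<Sum>i<n. \<Sum>j<n. x $ i * bar (y $ j) * form (\<lambda>l. g $$ (l, i)) (\<lambda>l. g $$ (l, j)))"
    if "x \<in> carrier_vec n" "y \<in> carrier_vec n" for x y
    using that by (simp add: skew_herm_form_eq gx form_bilinear[symmetric] mv cong: form_cong)
  have std: "form x y = (\<Sum>i<n. \<Sum>j<n. x i * bar (y j) * gram i j)" for x y
    by (auto simp: form_def gram_def if_distrib[of "(*) _"] algebra_simps cong: if_cong intro!: sum.cong)
  show ?thesis
  proof
    assume L: ?L
    show ?R
    proof (intro allI impI)
      fix i j assume i: "i < n" and j: "j < n"
      have c: "g *\<^sub>v unit_vec n k = col g k" if "k < n" for k
      proof (rule eq_vecI)
        fix l assume "l < dim_vec (col g k)"
        hence l: "l < n" using g by auto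
        have "(g *\<^sub>v unit_vec n k) $ l = (\<Sum>i<n. if i = k then g $$ (l, i) else 0)"
          using l that by (subst mv) (auto simp: unit_vec_def if_distrib[of "(*) _"] cong: if_cong)
        thus "(g *\<^sub>v unit_vec n k) $ l = col g k $ l" using g l that by simp
      qed (use g in auto)
      have "form (\<lambda>l. g $$ (l, i)) (\<lambda>l. g $$ (l, j)) = form (\<lambda>l. col g i $ l) (\<lambda>l. col g j $ l)"
        using g i j by (intro form_cong) auto
      also have "\<dots> = skew_herm_form r bar (g *\<^sub>v unit_vec n i) (g *\<^sub>v unit_vec n j)"
        using i j g by (subst skew_herm_form_eq) (auto simp: c intro: col_carrier_vec)
      also have "\<dots> = form (\<lambda>l. unit_vec n i $ l) (\<lambda>l. unit_vec n j $ l)"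
        using L by (simp add: skew_herm_form_eq)
      also have "\<dots> = (\<Sum>l<n. if l = i then (if j = star r i then eps r i else 0) else 0)"
        unfolding form_def using i j by (intro sum.cong refl) (auto simp: star_eq_iff star_swap)
      also have "\<dots> = gram i j" using i by (simp add: gram_def)
      finally show "form (\<lambda>l. g $$ (l, i)) (\<lambda>l. g $$ (l, j)) = gram i j" .
    qed
  next
    assume R: ?R
    show ?L
      using R by (auto simp: form_g skew_herm_form_eq std intro!: sum.cong)
  qed
qed

abbreviation G :: "'e mat monoid" where "G \<equiv> unitary_group r bar"

text \<open>A left inverse of a square matrix is also a right inverse, so the equation
  \<open>adj g * g = 1\<^sub>m n\<close> provides the invertibility asked for by the
  definition.\<close>

lemma carrier_G: "carrier G = {g \<in> carrier_mat n n. adj g * g = 1\<^sub>m n}"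
proof -
  have "invertible_mat g" if g: "g \<in> carrier_mat n n" and "adj g * g = 1\<^sub>m n" for g
    using that mat_mult_left_right_inverse[OF adj_carrier g]
    by (auto simp: invertible_mat_def inverts_mat_def square_mat.simps intro!: exI[of _ "adj g"])
  moreover have "(\<forall>x \<in> carrier_vec n. \<forall>y \<in> carrier_vec n.
        skew_herm_form r bar (g *\<^sub>v x) (g *\<^sub>v y) = skew_herm_form r bar x y) \<longleftrightarrow> adj g * g = 1\<^sub>m n"
    if "g \<in> carrier_mat n n" for g
    using that by (simp add: unitary_iff_form adj_mult_eq_one_iff)
  ultimately show ?thesis
    unfolding unitary_group_def two_r by auto
qed

lemma G_simps [simp]: "mult G = (*)" "one G = 1\<^sub>m n"
  by (auto simp: unitary_group_def dim)

lemma mat_nn_simps [simp]: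
  fixes A B :: "'e mat"
  shows "A \<in> carrier_mat n n \<Longrightarrow> B \<in> carrier_mat n n \<Longrightarrow> A * B \<in> carrier_mat n n"
  "A \<in> carrier_mat n n \<Longrightarrow> 1\<^sub>m n * A = A"
  "A \<in> carrier_mat n n \<Longrightarrow> A * 1\<^sub>m n = A"
  by auto

lemma assoc_nn:
  fixes A B C :: "'e mat"
  shows "A \<in> carrier_mat n n \<Longrightarrow> B \<in> carrier_mat n n \<Longrightarrow> C \<in> carrier_mat n n \<Longrightarrow>
    A * B * C = A * (B * C)" by (rule assoc_mult_mat)

lemma G_carrier_mat: "g \<in> carrier G \<Longrightarrow> g \<in> carrier_mat n n"
  and adj_left: "g \<in> carrier G \<Longrightarrow> adj g * g = 1\<^sub>m n"
  by (auto simp: carrier_G)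

lemma G_I: "g \<in> carrier_mat n n \<Longrightarrow> adj g * g = 1\<^sub>m n \<Longrightarrow> g \<in> carrier G"
  by (simp add: carrier_G)

lemma adj_right: "g \<in> carrier G \<Longrightarrow> g * adj g = 1\<^sub>m n"
  using mat_mult_left_right_inverse[OF adj_carrier] by (auto simp: carrier_G)

lemma adj_G: "g \<in> carrier G \<Longrightarrow> adj g \<in> carrier G"
  using adj_right by (auto simp: carrier_G adj_adj)

declare G_carrier_mat [simp]

lemma mult_G:
  assumes g: "g \<in> carrier G" and h: "h \<in> carrier G" shows "g * h \<in> carrier G"
proof -
  have "adj (g * h) * (g * h) = adj h * ((adj g * g) * h)"
    using g h by (simp add: adj_mult assoc_nn)
  thus ?thesis using g h adj_left[OF g] adj_left[OF h] by (intro G_I) auto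
qed

lemma one_G: "1\<^sub>m n \<in> carrier G"
proof -
  have "adj (1\<^sub>m n) = 1\<^sub>m n"
    by (rule eq_matI) (auto simp: adj_index hom_distribs star_eq_iff)
  thus ?thesis by (intro G_I) auto
qed

lemma group_G: "group G"
  by (rule groupI)
    (auto simp: mult_G one_G assoc_nn intro: adj_G adj_left)

sublocale group G by (rule group_G)

lemma inv_G: "g \<in> carrier G \<Longrightarrow> inv\<^bsub>G\<^esub> g = adj g"
  using adj_left adj_G by (intro inv_equality) auto

lemma cancel_left: "g \<in> carrier G \<Longrightarrow> x \<in> carrier_mat n n \<Longrightarrow> adj g * (g * x) = x"
  and cancel_left': "g \<in> carrier G \<Longrightarrow> x \<in> carrier_mat n n \<Longrightarrow> g * (adj g * x) = x"
  and cancel_right: "g \<in> carrier G \<Longrightarrow> x \<in> carrier_mat n n \<Longrightarrow> x * g * adj g = x"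
  and cancel_right': "g \<in> carrier G \<Longrightarrow> x \<in> carrier_mat n n \<Longrightarrow> x * adj g * g = x"
  by (simp_all add: assoc_nn[symmetric] adj_left adj_right) (simp_all add: assoc_nn adj_left adj_right)

lemma G_col_form:
  "g \<in> carrier G \<Longrightarrow> i < n \<Longrightarrow> j < n \<Longrightarrow>
    form (\<lambda>l. g $$ (l, i)) (\<lambda>l. g $$ (l, j)) = gram i j"
  using adj_mult_eq_one_iff adj_left by auto

lemma G_memI:
  "g \<in> carrier_mat n n \<Longrightarrow> (\<And>i j. i < n \<Longrightarrow> j < n \<Longrightarrow>
    form (\<lambda>l. g $$ (l, i)) (\<lambda>l. g $$ (l, j)) = gram i j) \<Longrightarrow> g \<in> carrier G"
  using adj_mult_eq_one_iff by (intro G_I) auto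

end

section \<open>Triangular subgroups modulo a prime ideal; the Borel subgroup\<close>

section \<open>Subgroups that are triangular modulo a prime ideal\<close>

text \<open>A subring \<open>R\<close> with a prime ideal \<open>M\<close>, both stable under
  \<open>bar\<close>. One development serves the Borel subgroup (\<open>UNIV\<close> and
  \<open>{0}\<close>) and the Iwahori subgroup (\<open>val_ring v\<close> and
  \<open>max_ideal v\<close>).\<close>

locale bar_stable_prime = unitary_space bar r n for bar :: "'e::field \<Rightarrow> 'e" and r n +
  fixes R M :: "'e set"
  assumes M_subset: "M \<subseteq> R" and zero_M: "0 \<in> M" and one_R: "1 \<in> R" and one_M: "1 \<notin> M"
    and R_add: "x \<in> R \<Longrightarrow> y \<in> R \<Longrightarrow> x + y \<in> R"
    and R_mult: "x \<in> R \<Longrightarrow> y \<in> R \<Longrightarrow> x * y \<in> R"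
    and R_bar: "x \<in> R \<Longrightarrow> bar x \<in> R"
    and M_add: "x \<in> M \<Longrightarrow> y \<in> M \<Longrightarrow> x + y \<in> M"
    and M_mult: "x \<in> R \<Longrightarrow> y \<in> M \<Longrightarrow> x * y \<in> M"
    and M_uminus: "x \<in> M \<Longrightarrow> - x \<in> M" and R_uminus: "x \<in> R \<Longrightarrow> - x \<in> R"
    and M_bar: "x \<in> M \<Longrightarrow> bar x \<in> M"
    and prime: "x \<in> R \<Longrightarrow> y \<in> R \<Longrightarrow> x * y \<in> M \<Longrightarrow> x \<in> M \<or> y \<in> M"
begin

lemma M_mult': "x \<in> M \<Longrightarrow> y \<in> R \<Longrightarrow> x * y \<in> M"
  using M_mult[of y x] by (simp add: mult.commute)

lemma M_sum: "(\<And>i. i \<in> A \<Longrightarrow> f i \<in> M) \<Longrightarrow> sum f A \<in> M"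
  by (induction A rule: infinite_finite_induct) (auto intro: zero_M M_add)

lemma R_sum: "(\<And>i. i \<in> A \<Longrightarrow> f i \<in> R) \<Longrightarrow> sum f A \<in> R"
  using zero_M M_subset by (induction A rule: infinite_finite_induct) (auto intro: R_add)

lemma M_cancel: "x \<in> M \<Longrightarrow> x + y \<in> M \<longleftrightarrow> y \<in> M"
  using M_add[of "- x" "x + y"] M_add[of x y] M_uminus[of x] by auto

definition tri :: "'e mat set" where
  "tri = {g \<in> carrier G. (\<forall>i<n. \<forall>j<n. g $$ (i, j) \<in> R) \<and>
     (\<forall>i<n. \<forall>j<n. rank r j < rank r i \<longrightarrow> g $$ (i, j) \<in> M)}"

lemma triD:
  assumes "g \<in> tri"
  shows "g \<in> carrier G" "i < n \<Longrightarrow> j < n \<Longrightarrow> g $$ (i, j) \<in> R"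
    "i < n \<Longrightarrow> j < n \<Longrightarrow> rank r j < rank r i \<Longrightarrow> g $$ (i, j) \<in> M"
  using assms by (auto simp: tri_def)

text \<open>The entry of \<open>adj g\<close> at \<open>(i, j)\<close> comes from \<open>g\<close>
  at \<open>(star r j, star r i)\<close>, and \<open>star\<close> reverses ranks.\<close>

lemma tri_adj: assumes "g \<in> tri" shows "adj g \<in> tri"
proof -
  have e: "eps r i * eps r j * x \<in> M" if "x \<in> M" for x i j
    using that M_uminus by (auto simp: eps_def)
  have e': "eps r i * eps r j * x \<in> R" if "x \<in> R" for x i j
    using that R_uminus by (auto simp: eps_def)
  show ?thesis
    using triD[OF assms] by (auto simp: tri_def adj_G adj_index rank_star_less_iff intro!: e e' M_bar R_bar)
qed

text \<open>If \<open>j\<close> has smaller rank than \<open>i\<close>, every intermediate index has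
  rank above that of \<open>j\<close> or below that of \<open>i\<close>, so one of the two factors
  lies in \<open>M\<close>.\<close>

lemma tri_mult: assumes g: "g \<in> tri" and h: "h \<in> tri" shows "g * h \<in> tri"
proof -
  note gG = triD(1)[OF g] and hG = triD(1)[OF h]
  note entry = mat_mult_entry[OF G_carrier_mat[OF gG] G_carrier_mat[OF hG]]
  have "(g * h) $$ (i, j) \<in> R" if "i < n" "j < n" for i j
    using that triD[OF g] triD[OF h] by (auto simp: entry intro!: R_sum R_mult)
  moreover have "(g * h) $$ (i, j) \<in> M" if i: "i < n" and j: "j < n" and ij: "rank r j < rank r i" for i j
    unfolding entry[OF i j]
  proof (rule M_sum)
    fix l assume "l \<in> {..<n}"
    hence l: "l < n" by simp
    show "g $$ (i, l) * h $$ (l, j) \<in> M"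
    proof (cases "rank r j < rank r l")
      case True thus ?thesis using triD[OF g] triD[OF h] i j l by (intro M_mult) auto
    next
      case False
      hence "rank r l < rank r i" using ij by simp
      thus ?thesis using triD[OF g] triD[OF h] i j l by (intro M_mult') auto
    qed
  qed
  ultimately show ?thesis using mult_G[OF gG hG] by (auto simp: tri_def)
qed

lemma one_tri: "1\<^sub>m n \<in> tri"
  using one_G one_R zero_M M_subset by (auto simp: tri_def)

lemma tri_subgroup: "subgroup tri G"
  by (rule subgroupI) (use one_tri in \<open>auto simp: inv_G triD(1) tri_adj tri_mult\<close>)

text \<open>Otherwise every term of the diagonal entry of \<open>g * adj g\<close> would lie in
  \<open>M\<close>, although that entry is 1.\<close>

lemma tri_diag: assumes g: "g \<in> tri" and i: "i < n" shows "g $$ (i, i) \<notin> M"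
proof
  assume gii: "g $$ (i, i) \<in> M"
  note gG = triD(1)[OF g] and h = tri_adj[OF g]
  have "(\<Sum>l<n. g $$ (i, l) * adj g $$ (l, i)) \<in> M"
  proof (rule M_sum)
    fix l assume "l \<in> {..<n}"
    hence l: "l < n" by simp
    consider "l = i" | "rank r l < rank r i" | "rank r i < rank r l"
      using rank_inj[OF l i] by linarith
    thus "g $$ (i, l) * adj g $$ (l, i) \<in> M"
      using gii triD[OF g] triD[OF h] i l by cases (auto intro: M_mult M_mult')
  qed
  also have "(\<Sum>l<n. g $$ (i, l) * adj g $$ (l, i)) = 1"
    using mat_mult_entry[OF G_carrier_mat[OF gG] adj_carrier[of g] i i] adj_right[OF gG] i by simp
  finally show False using one_M by simp
qed

text \<open>Over the domain \<open>R/M\<close>: if \<open>a\<close> is lower triangular and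
  \<open>a\<close> times the transpose of \<open>d\<close> is diagonal with nonzero entries, that
  transpose is lower triangular too. This is forward substitution, by induction on the column of
  \<open>d\<close>.\<close>

lemma prime_triangular:
  fixes a d :: "nat \<Rightarrow> nat \<Rightarrow> 'e"
  assumes aR: "\<And>i j. i < r \<Longrightarrow> j < r \<Longrightarrow> a i j \<in> R" and dR: "\<And>i j. i < r \<Longrightarrow> j < r \<Longrightarrow> d i j \<in> R"
    and aM: "\<And>i j. i < j \<Longrightarrow> j < r \<Longrightarrow> a i j \<in> M"
    and off: "\<And>i j. i < r \<Longrightarrow> j < r \<Longrightarrow> i \<noteq> j \<Longrightarrow> (\<Sum>l<r. a i l * d j l) \<in> M"
    and diag: "\<And>i. i < r \<Longrightarrow> (\<Sum>l<r. a i l * d i l) \<notin> M"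
    and "i < j" "j < r"
  shows "d j i \<in> M"
proof -
  have "\<forall>j. i < j \<longrightarrow> j < r \<longrightarrow> d j i \<in> M" if "i < r" for i
    using that
  proof (induction i rule: less_induct)
    case (less i)
    \<comment> \<open>Modulo \<open>M\<close> only the term \<open>l = i\<close> survives: for
      \<open>l > i\<close> the factor \<open>a i l\<close> vanishes, for \<open>l < i\<close> the
      factor \<open>d j l\<close> does by induction. The case \<open>j = i\<close> then shows that
      \<open>a i i\<close> can be cancelled.\<close>
    have split: "(\<Sum>l<r. a i l * d j l) \<in> M \<longleftrightarrow> a i i * d j i \<in> M" if "i \<le> j" "j < r" for j
    proof -
      have "(\<Sum>l\<in>{..<r} - {i}. a i l * d j l) \<in> M"
      proof (rule M_sum)
        fix l assume l: "l \<in> {..<r} - {i}"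
        show "a i l * d j l \<in> M"
        proof (cases "i < l")
          case True thus ?thesis using l that aM dR by (intro M_mult') auto
        next
          case False
          thus ?thesis using l that less.IH[of l] less.prems aR by (intro M_mult) auto
        qed
      qed
      moreover have "(\<Sum>l<r. a i l * d j l) = (\<Sum>l\<in>{..<r} - {i}. a i l * d j l) + a i i * d j i"
        using less.prems by (subst sum.remove[of _ i]) auto
      ultimately show ?thesis by (simp add: M_cancel)
    qed
    have "a i i \<notin> M"
      using diag[OF less.prems] split[of i] M_mult' less.prems dR by auto
    thus ?case
      using split off prime aR dR less.prems by (metis less_imp_le less_irrefl)
  qed
  thus ?thesis using assms by auto
qed

text \<open>The lower right block needs no condition of its own: modulo \<open>M\<close> the
  equation \<open>g * adj g = 1\<^sub>m n\<close> makes its conjugate transpose inverse to the upper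
  left block, and \<open>prime_triangular\<close> applies.\<close>

lemma triI:
  assumes g: "g \<in> carrier G" and R: "\<And>i j. i < n \<Longrightarrow> j < n \<Longrightarrow> g $$ (i, j) \<in> R"
    and c: "\<And>i j. r \<le> i \<Longrightarrow> i < n \<Longrightarrow> j < r \<Longrightarrow> g $$ (i, j) \<in> M"
    and a: "\<And>i j. i < j \<Longrightarrow> j < r \<Longrightarrow> g $$ (i, j) \<in> M"
  shows "g \<in> tri"
proof -
  \<comment> \<open>The upper left block times the conjugate transpose of the lower right
    block.\<close>
  define S where "S i j = (\<Sum>l<r. g $$ (i, l) * bar (g $$ (j + r, l + r)))" for i j
  have S: "(if i = j then 1 else 0) - S i j \<in> M" if i: "i < r" and j: "j < r" for i j
  proof -
    have n: "{..<n} = {..<r} \<union> {r..<n}" using dim by auto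
    have ul: "adj g $$ (l, j) = bar (g $$ (j + r, l + r))" if "l < r" for l
      using that j by (subst adj_index) (auto simp: star_def eps_def dim)
    have "(if i = j then 1 else 0) = (g * adj g) $$ (i, j)"
      using i j dim adj_right[OF g] by auto
    also have "\<dots> = (\<Sum>l<n. g $$ (i, l) * adj g $$ (l, j))"
      using i j dim by (subst mat_mult_entry[OF G_carrier_mat[OF g] adj_carrier]) auto
    also have "\<dots> = S i j + (\<Sum>l\<in>{r..<n}. g $$ (i, l) * adj g $$ (l, j))"
      unfolding n S_def by (subst sum.union_disjoint) (auto simp: ul)
    finally have "(if i = j then 1 else 0) - S i j = (\<Sum>l\<in>{r..<n}. g $$ (i, l) * adj g $$ (l, j))"
      by (simp only: add_diff_cancel_left')
    also have "\<dots> \<in> M"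
    proof (rule M_sum)
      fix l assume l: "l \<in> {r..<n}"
      \<comment> \<open>For \<open>l\<close> in the second half, \<open>adj g\<close> at
        \<open>(l, j)\<close> comes from the lower left block of \<open>g\<close>.\<close>
      have "g $$ (star r j, star r l) \<in> M"
        using l i j dim by (intro c) (auto simp: star_def)
      hence "adj g $$ (l, j) \<in> M"
        using l i j dim by (subst adj_index) (auto simp: eps_def intro!: M_uminus M_bar)
      thus "g $$ (i, l) * adj g $$ (l, j) \<in> M" using l i dim by (intro M_mult R) auto
    qed
    finally show ?thesis .
  qed
  have d: "bar (g $$ (j + r, i + r)) \<in> M" if "i < j" "j < r" for i j
  proof (rule prime_triangular[where a = "\<lambda>i j. g $$ (i, j)" and d = "\<lambda>i j. bar (g $$ (i + r, j + r))"])
    fix i j assume "i < r" "j < r" "i \<noteq> j"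
    thus "(\<Sum>l<r. g $$ (i, l) * bar (g $$ (j + r, l + r))) \<in> M"
      using S[of i j] M_uminus[of "- S i j"] by (simp add: S_def)
  next
    fix i assume "i < r"
    thus "(\<Sum>l<r. g $$ (i, l) * bar (g $$ (i + r, l + r))) \<notin> M"
      using S[of i i] M_add[of "1 - S i i" "S i i"] one_M by (auto simp: S_def)
  qed (use that a R dim in \<open>auto intro!: R_bar\<close>)
  have "g $$ (i, j) \<in> M" if i: "i < n" and j: "j < n" and ij: "rank r j < rank r i" for i j
  proof -
    consider "i < r" "j < r" | "r \<le> i" "j < r" | "r \<le> i" "r \<le> j"
      using ij j dim by (auto simp: rank_def split: if_splits)
    thus ?thesis
    proof cases
      case 3
      have "bar (g $$ (i - r + r, j - r + r)) \<in> M"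
        using 3 ij i dim by (intro d) (auto simp: rank_def)
      from M_bar[OF this] show ?thesis using 3 by simp
    qed (use i ij a c in \<open>auto simp: rank_def\<close>)
  qed
  thus ?thesis using g R by (auto simp: tri_def)
qed

end

sublocale unitary_space \<subseteq> borel: bar_stable_prime bar r n UNIV "{0}"
  by unfold_locales auto

text \<open>For the inclusion of \<open>borel.tri\<close>, the witness \<open>a'\<close> is the
  transpose of the lower right block. That it inverts the conjugate of \<open>a\<close> is the upper
  left block of \<open>adj g * g = 1\<^sub>m n\<close>, after applying \<open>bar\<close>.\<close>

lemma (in unitary_space) borel_subgroup_eq: "borel_subgroup r bar = borel.tri"
proof (intro Set.set_eqI iffI)
  fix g assume "g \<in> borel_subgroup r bar"
  then obtain a b a' where g: "g \<in> carrier G" "a \<in> carrier_mat r r" "b \<in> carrier_mat r r" "a' \<in> carrier_mat r r"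
     "\<forall>i j. i < j \<longrightarrow> j < r \<longrightarrow> a $$ (i, j) = 0" "g = four_block_mat a b (0\<^sub>m r r) (transpose_mat a')"
    by (auto simp: borel_subgroup_def)
  thus "g \<in> borel.tri"
    using dim by (intro borel.triI) auto
next
  fix g assume g: "g \<in> borel.tri"
  note gG = borel.triD(1)[OF g] and zero = borel.triD(3)[OF g]
  define a b a' where "a = mat r r (\<lambda>(i, j). g $$ (i, j))" and "b = mat r r (\<lambda>(i, j). g $$ (i, j + r))"
    and "a' = mat r r (\<lambda>(i, j). g $$ (j + r, i + r))"
  have [simp]: "a \<in> carrier_mat r r" "b \<in> carrier_mat r r" "a' \<in> carrier_mat r r"
    by (auto simp: a_def b_def a'_def)
  have blocks: "g = four_block_mat a b (0\<^sub>m r r) (transpose_mat a')"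
  proof (rule eq_matI)
    fix i j assume "i < dim_row (four_block_mat a b (0\<^sub>m r r) (transpose_mat a'))"
      "j < dim_col (four_block_mat a b (0\<^sub>m r r) (transpose_mat a'))"
    hence ij: "i < n" "j < n" using dim by (auto simp: a_def a'_def)
    have "g $$ (i, j) = 0" if "\<not> i < r" "j < r"
      using that ij dim zero[of i j] by (auto simp: rank_def)
    thus "g $$ (i, j) = four_block_mat a b (0\<^sub>m r r) (transpose_mat a') $$ (i, j)"
      using ij dim by (auto simp: a_def b_def a'_def)
  qed (use gG G_carrier_mat[OF gG] dim in \<open>auto simp: a_def a'_def\<close>)
  have inv: "a' * map_mat bar a = 1\<^sub>m r"
  proof (rule eq_matI)
    fix i j assume "i < dim_row (1\<^sub>m r :: 'e mat)" "j < dim_col (1\<^sub>m r :: 'e mat)"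
    hence i: "i < r" and j: "j < r" by auto
    hence i': "i < n" and j': "j < n" using dim by auto
    have n: "{..<n} = {..<r} \<union> {r..<n}" using dim by auto
    have z: "g $$ (l, j) = 0" if "r \<le> l" "l < n" for l
      using that j zero[of l j] by (auto simp: rank_def)
    have ul: "adj g $$ (i, l) = bar (g $$ (l + r, i + r))" if "l < r" for l
      using that i by (subst adj_index) (auto simp: star_def eps_def dim)
    have "(1\<^sub>m n :: 'e mat) $$ (i, j) = (\<Sum>l<n. adj g $$ (i, l) * g $$ (l, j))"
      using mat_mult_entry[OF adj_carrier[of g] G_carrier_mat[OF gG] i' j'] adj_left[OF gG] by simp
    also have "\<dots> = (\<Sum>l<r. bar (g $$ (l + r, i + r)) * g $$ (l, j))"
      unfolding n by (subst sum.union_disjoint) (auto simp: ul z)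
    finally have "(\<Sum>l<r. bar (g $$ (l + r, i + r)) * g $$ (l, j)) = (if i = j then 1 else 0)"
      using i' j' by simp
    from arg_cong[OF this, of bar]
    show "(a' * map_mat bar a) $$ (i, j) = 1\<^sub>m r $$ (i, j)"
      using i j by (subst mat_mult_entry[of _ r r _ r]) (auto simp: a_def a'_def hom_sum hom_mult)
  qed (auto simp: a_def a'_def)
  hence "map_mat bar a * a' = 1\<^sub>m r"
    using mat_mult_left_right_inverse[of a' r "map_mat bar a"] by simp
  with inv have invs: "inverts_mat (map_mat bar a) a'" "inverts_mat a' (map_mat bar a)"
    by (auto simp: inverts_mat_def a_def a'_def)
  have low: "a $$ (i, j) = 0" if "i < j" "j < r" for i j
    using that zero[of i j] dim by (auto simp: a_def rank_def)
  show "g \<in> borel_subgroup r bar"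
    unfolding borel_subgroup_def mem_Collect_eq
    by (rule conjI[OF gG], rule exI[of _ a], rule exI[of _ b], rule exI[of _ a'])
      (use low invs blocks in \<open>intro conjI allI impI; simp\<close>)
qed


section \<open>Stabilizers of scaled coordinate lattices; the groups \<open>K_r\<close>,
  \<open>I_r\<close> and \<open>L_r\<close>\<close>

section \<open>Lattice stabilizers\<close>

lemma discrete_valuation_uminus:
  assumes "discrete_valuation v" shows "v (- x) = v x"
proof (cases "x = 0")
  case False
  have mult: "y \<noteq> 0 \<Longrightarrow> z \<noteq> 0 \<Longrightarrow> v (y * z) = v y + v z" for y z
    using assms by (auto simp: discrete_valuation_def)
  have "v 1 = 0" using mult[of 1 1] by simp
  hence "v (- 1) = 0" using mult[of "- 1" "- 1"] by simp
  thus ?thesis using mult[of "- 1" x] False by simp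
qed simp

text \<open>Collects the arithmetic input: \<open>bar\<close> preserves the valuation and negates
  the uniformizer. Both are derived for ramified quadratic extensions in
  \<open>valued_unitary_space_ramified\<close>.\<close>

locale valued_unitary_space = unitary_space bar r n for bar :: "'e::field \<Rightarrow> 'e" and r n +
  fixes v :: "'e \<Rightarrow> int" and \<pi> :: 'e
  assumes valuation: "discrete_valuation v" and v_bar: "v (bar x) = v x"
    and bar_pi [simp]: "bar \<pi> = - \<pi>" and pi_nonzero [simp]: "\<pi> \<noteq> 0" and v_pi: "v \<pi> = 1"
begin

lemma v_mult: "x \<noteq> 0 \<Longrightarrow> y \<noteq> 0 \<Longrightarrow> v (x * y) = v x + v y"
  and v_add: "x \<noteq> 0 \<Longrightarrow> y \<noteq> 0 \<Longrightarrow> x + y \<noteq> 0 \<Longrightarrow> min (v x) (v y) \<le> v (x + y)"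
  using valuation by (auto simp: discrete_valuation_def)

lemma v_one [simp]: "v 1 = 0"
  using v_mult[of 1 1] by simp

lemma v_minus [simp]: "v (- x) = v x"
  by (rule discrete_valuation_uminus[OF valuation])

lemma v_divide: "x \<noteq> 0 \<Longrightarrow> y \<noteq> 0 \<Longrightarrow> v (x / y) = v x - v y"
  using v_mult[of "x / y" y] by simp

lemma val_ge_add: "x \<in> val_ge v N \<Longrightarrow> y \<in> val_ge v N \<Longrightarrow> x + y \<in> val_ge v N"
  using v_add[of x y] by (cases "x = 0"; cases "y = 0"; cases "x + y = 0") (auto simp: val_ge_def)

lemma val_ge_mult: "x \<in> val_ge v N \<Longrightarrow> y \<in> val_ge v N' \<Longrightarrow> x * y \<in> val_ge v (N + N')"
  by (cases "x = 0"; cases "y = 0") (auto simp: val_ge_def v_mult)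

sublocale iw: bar_stable_prime bar r n "val_ring v" "max_ideal v"
proof
  fix x y assume "x \<in> val_ring v" "y \<in> val_ring v" "x * y \<in> max_ideal v"
  thus "x \<in> max_ideal v \<or> y \<in> max_ideal v"
    by (cases "x = 0"; cases "y = 0") (auto simp: val_ge_def v_mult)
qed (use val_ge_mult[of _ 0 _ 0] val_ge_mult[of _ 0 _ 1] in \<open>auto simp: val_ge_add, auto simp: val_ge_def v_bar\<close>)

lemma max_ideal_divide: "x / \<pi> \<in> val_ring v \<longleftrightarrow> x \<in> max_ideal v"
  by (cases "x = 0") (auto simp: val_ge_def v_divide v_pi)

lemma pi_mult: "x \<in> val_ring v \<Longrightarrow> x * \<pi> \<in> val_ring v"
  by (cases "x = 0") (auto simp: val_ge_def v_mult v_pi)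

text \<open>The lattice with basis \<open>c i * e_i\<close>. Both lattices of the statement have
  this form, with \<open>c\<close> constantly 1 and \<open>c = wt\<close>.\<close>

definition scaled_lattice :: "(nat \<Rightarrow> 'e) \<Rightarrow> 'e vec set" where
  "scaled_lattice c = {x \<in> carrier_vec n. \<forall>i<n. x $ i \<in> (\<lambda>y. c i * y) ` val_ring v}"

lemma scaled_lattice_iff:
  assumes "\<And>i. i < n \<Longrightarrow> c i \<noteq> 0"
  shows "x \<in> scaled_lattice c \<longleftrightarrow> x \<in> carrier_vec n \<and> (\<forall>i<n. x $ i / c i \<in> val_ring v)"
proof -
  have "x $ i \<in> (\<lambda>y. c i * y) ` val_ring v \<longleftrightarrow> x $ i / c i \<in> val_ring v" if "i < n" for i
    using assms[OF that] by (auto intro: rev_image_eqI)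
  thus ?thesis by (auto simp: scaled_lattice_def)
qed

text \<open>The condition on \<open>c\<close> says that the lattice is self-dual up to scaling.\<close>

lemma stabilizer_scaled_lattice:
  assumes c0: "\<And>i. i < n \<Longrightarrow> c i \<noteq> 0" and bar_c: "\<And>i. i < n \<Longrightarrow> bar (c i) = c i \<or> bar (c i) = - c i"
    and c_star: "\<And>i. i < n \<Longrightarrow> c i * c (star r i) = \<kappa>"
  defines "S \<equiv> {g \<in> carrier G. \<forall>i<n. \<forall>j<n. g $$ (i, j) * c j / c i \<in> val_ring v}"
  shows "lattice_stabilizer G (scaled_lattice c) = S"
    and "subgroup S G"
proof -
  have adj_S: "adj g \<in> S" if g: "g \<in> S" for g
  proof -
    have "adj g $$ (i, j) * c j / c i \<in> val_ring v" if i: "i < n" and j: "j < n" for i j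
    proof -
      let ?x = "g $$ (star r j, star r i) * c (star r i) / c (star r j)"
      \<comment> \<open>Self-duality turns integrality of the entry \<open>(i, j)\<close> of
        \<open>adj g\<close> into integrality of the entry \<open>(star r j, star r i)\<close> of
        \<open>g\<close>.\<close>
      have "c j / c i = c (star r i) / c (star r j)"
        using c_star[OF i] c_star[OF j] c0[OF i] c0[OF j] c0[of "star r j"] i j
        by (simp add: field_simps)
      hence "adj g $$ (i, j) * c j / c i = eps r i * eps r j * (bar (g $$ (star r j, star r i)) * (c (star r i) / c (star r j)))"
        using i j by (simp add: adj_index times_divide_eq_right[symmetric] del: times_divide_eq_right)
      also have "\<dots> = bar ?x \<or> \<dots> = - bar ?x"
        using bar_c[of "star r i"] bar_c[of "star r j"] i j
        by (auto simp: eps_def hom_mult hom_inverse divide_inverse)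
      moreover have "?x \<in> val_ring v" using g i j by (auto simp: S_def)
      ultimately show ?thesis using iw.R_bar iw.R_uminus by metis
    qed
    thus ?thesis using g by (auto simp: S_def adj_G)
  qed
  have mv: "(g *\<^sub>v x) $ i = (\<Sum>j<n. g $$ (i, j) * x $ j)" if "g \<in> carrier G" "x \<in> carrier_vec n" "i < n" for g x i
    using that carrier_matD[OF G_carrier_mat[OF that(1)]] by (auto simp: scalar_prod_def lessThan_atLeast0 intro!: sum.cong)
  have into: "g *\<^sub>v x \<in> scaled_lattice c" if g: "g \<in> S" and x: "x \<in> scaled_lattice c" for g x
  proof -
    have gG: "g \<in> carrier G" using g by (simp add: S_def)
    have "\<forall>i<n. (g *\<^sub>v x) $ i / c i \<in> val_ring v"
    proof (intro allI impI)
      fix i assume i: "i < n"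
      have "(g *\<^sub>v x) $ i / c i = (\<Sum>j<n. (g $$ (i, j) * c j / c i) * (x $ j / c j))"
        using x i gG c0 by (auto simp: mv scaled_lattice_iff sum_divide_distrib intro!: sum.cong)
      also have "\<dots> \<in> val_ring v"
        using g x i c0 by (intro iw.R_sum iw.R_mult) (auto simp: S_def scaled_lattice_iff)
      finally show "(g *\<^sub>v x) $ i / c i \<in> val_ring v" .
    qed
    moreover have "g *\<^sub>v x \<in> carrier_vec n"
      using x mult_mat_vec_carrier[OF G_carrier_mat[OF gG]] by (simp add: scaled_lattice_def)
    ultimately show ?thesis using scaled_lattice_iff[of c] c0 by blast
  qed
  show stab: "lattice_stabilizer G (scaled_lattice c) = S"
  proof (intro Set.set_eqI iffI)
    fix g assume "g \<in> lattice_stabilizer G (scaled_lattice c)"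
    hence g: "g \<in> carrier G" and im: "(\<lambda>x. g *\<^sub>v x) ` scaled_lattice c = scaled_lattice c"
      by (auto simp: lattice_stabilizer_def)
    have "g $$ (i, j) * c j / c i \<in> val_ring v" if i: "i < n" and j: "j < n" for i j
    proof -
      \<comment> \<open>The lattice vector \<open>c j * e_j\<close> isolates the entry
        \<open>(i, j)\<close>.\<close>
      let ?x = "vec n (\<lambda>k. if k = j then c j else 0)"
      have "?x \<in> scaled_lattice c"
        using c0 j iw.one_R iw.zero_M iw.M_subset by (auto simp: scaled_lattice_iff)
      hence "g *\<^sub>v ?x \<in> scaled_lattice c" using im by blast
      hence "(g *\<^sub>v ?x) $ i / c i \<in> val_ring v" using i c0 by (auto simp: scaled_lattice_iff)
      also have "(g *\<^sub>v ?x) $ i = g $$ (i, j) * c j"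
        using g i j by (auto simp: mv if_distrib[of "(*) _"] cong: if_cong)
      finally show ?thesis .
    qed
    thus "g \<in> S" using g by (auto simp: S_def)
  next
    fix g assume g: "g \<in> S"
    hence gG: "g \<in> carrier G" by (simp add: S_def)
    have "x \<in> (\<lambda>x. g *\<^sub>v x) ` scaled_lattice c" if x: "x \<in> scaled_lattice c" for x
    proof -
      have "x = g *\<^sub>v (adj g *\<^sub>v x)"
        using x gG adj_right[OF gG] G_carrier_mat[OF gG]
        by (auto simp: scaled_lattice_def assoc_mult_mat_vec[symmetric, of _ n n _ n])
      thus ?thesis using into[OF adj_S[OF g] x] by blast
    qed
    thus "g \<in> lattice_stabilizer G (scaled_lattice c)"
      using into[OF g] gG by (auto simp: lattice_stabilizer_def)
  qed
  show "subgroup S G"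
  proof (rule subgroupI)
    show "S \<subseteq> carrier G" by (auto simp: S_def)
    have "1\<^sub>m n \<in> S" using one_G iw.one_R iw.zero_M iw.M_subset c0 by (auto simp: S_def)
    thus "S \<noteq> {}" by auto
  next
    fix g h assume g: "g \<in> S" and h: "h \<in> S"
    hence gh: "g \<in> carrier G" "h \<in> carrier G" by (auto simp: S_def)
    have "(g * h) $$ (i, j) * c j / c i \<in> val_ring v" if i: "i < n" and j: "j < n" for i j
    proof -
      have "(g * h) $$ (i, j) * c j / c i
          = (\<Sum>l<n. (g $$ (i, l) * c l / c i) * (h $$ (l, j) * c j / c l))"
        using i j gh c0 by (auto simp: mat_mult_entry[of _ n n _ n] sum_divide_distrib sum_distrib_right intro!: sum.cong)
      also have "\<dots> \<in> val_ring v"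
        using g h i j by (intro iw.R_sum iw.R_mult) (auto simp: S_def)
      finally show ?thesis .
    qed
    thus "g \<otimes>\<^bsub>G\<^esub> h \<in> S" using gh by (auto simp: S_def mult_G)
  next
    fix g assume g: "g \<in> S"
    thus "inv\<^bsub>G\<^esub> g \<in> S" using adj_S[OF g] inv_G by (auto simp: S_def)
  qed
qed

lemma K_group_eq: "K_group r bar v = {g \<in> carrier G. \<forall>i<n. \<forall>j<n. g $$ (i, j) \<in> val_ring v}"
proof -
  have "std_lattice r v = scaled_lattice (\<lambda>_. 1)"
    by (auto simp: std_lattice_def scaled_lattice_def two_r)
  thus ?thesis
    using stabilizer_scaled_lattice(1)[of "\<lambda>_. 1" 1] by (simp add: K_group_def)
qed

lemma iwahori_eq: "iwahori r bar v = iw.tri"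
proof (intro Set.set_eqI iffI)
  fix g assume "g \<in> iwahori r bar v"
  thus "g \<in> iw.tri" unfolding iwahori_def K_group_eq two_r by (intro iw.triI) auto
next
  fix g assume "g \<in> iw.tri"
  thus "g \<in> iwahori r bar v"
    unfolding iwahori_def K_group_eq two_r
    by (auto simp: rank_def dim intro: iw.triD(1,2) intro!: iw.triD(3))
qed

text \<open>The diagonal of the matrix \<open>D\<close> whose columns span the lattice fixed by
  \<open>L_r\<close>.\<close>

definition wt :: "nat \<Rightarrow> 'e" where
  "wt i = (if i < r then 1 else \<pi>)"

lemma wt_nonzero [simp]: "wt i \<noteq> 0"
  by (simp add: wt_def)

lemma L_group_eq: "L_group r bar v \<pi> =
    {g \<in> carrier G. \<forall>i<n. \<forall>j<n. g $$ (i, j) * wt j / wt i \<in> val_ring v}" (is ?eq)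
  and L_subgroup: "subgroup (L_group r bar v \<pi>) G"
proof -
  have "lattice' r v \<pi> = scaled_lattice wt"
  proof (intro Set.set_eqI)
    fix x :: "'e vec"
    have "(\<forall>i<r. x $ i \<in> val_ring v) \<and> (\<forall>i\<in>{r..<n}. x $ i \<in> (\<lambda>x. \<pi> * x) ` val_ring v)
        \<longleftrightarrow> (\<forall>i<n. x $ i \<in> (\<lambda>y. wt i * y) ` val_ring v)"
      using dim by (auto simp: wt_def)
    thus "x \<in> lattice' r v \<pi> \<longleftrightarrow> x \<in> scaled_lattice wt"
      by (simp add: lattice'_def scaled_lattice_def two_r)
  qed
  moreover have "bar (wt i) = wt i \<or> bar (wt i) = - wt i" for i by (simp add: wt_def)
  moreover have "wt i * wt (star r i) = \<pi>" if "i < n" for i using that dim by (auto simp: wt_def star_def)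
  ultimately show ?eq "subgroup (L_group r bar v \<pi>) G"
    using stabilizer_scaled_lattice[of wt \<pi>] by (auto simp: L_group_def)
qed

text \<open>Passing to the lattice of \<open>L_r\<close> divides the lower left block by
  \<open>\<pi>\<close>. This is harmless, because the entries there lie in the maximal
  ideal.\<close>

lemma iwahori_subset_L: "iw.tri \<subseteq> L_group r bar v \<pi>"
proof
  fix g assume g: "g \<in> iw.tri"
  have "g $$ (i, j) * wt j / wt i \<in> val_ring v" if i: "i < n" and j: "j < n" for i j
    using iw.triD(2,3)[OF g i j] i j dim
    by (cases "i < r"; cases "j < r") (auto simp: wt_def max_ideal_divide rank_def intro: pi_mult)
  thus "g \<in> L_group r bar v \<pi>" using iw.triD(1)[OF g] by (auto simp: L_group_eq)
qed

end

section \<open>Monomial unitary matrices and the normalizer of the torus\<close>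

section \<open>The torus and the Weyl group\<close>

context unitary_space
begin

text \<open>Monomial matrices, recorded by the position of the nonzero entry in each column.
  Multiplication composes the patterns.\<close>

definition pat :: "'e mat \<Rightarrow> (nat \<Rightarrow> nat) \<Rightarrow> bool" where
  "pat g \<sigma> \<longleftrightarrow> (\<forall>i<n. \<forall>j<n. g $$ (i, j) \<noteq> 0 \<longleftrightarrow> i = \<sigma> j)"

text \<open>The group of signed permutations of \<open>r\<close> letters, realized as the
  permutations of the \<open>2 * r\<close> basis indices that respect the pairs
  \<open>{i, star r i}\<close>.\<close>

definition weyl_perms :: "(nat \<Rightarrow> nat) set" where
  "weyl_perms = {\<sigma>. \<sigma> permutes {..<n} \<and> (\<forall>i<n. \<sigma> (star r i) = star r (\<sigma> i))}"

lemma perm_less [simp]: "\<sigma> permutes {..<n} \<Longrightarrow> \<sigma> i < n \<longleftrightarrow> i < n"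
  using permutes_in_image[of \<sigma> "{..<n}" i] by simp

lemma patD: "pat g \<sigma> \<Longrightarrow> i < n \<Longrightarrow> j < n \<Longrightarrow> g $$ (i, j) \<noteq> 0 \<longleftrightarrow> i = \<sigma> j"
  by (simp add: pat_def)

lemma weyl_permsD:
  assumes "\<sigma> \<in> weyl_perms"
  shows "\<sigma> permutes {..<n}" "i < n \<Longrightarrow> \<sigma> (star r i) = star r (\<sigma> i)" "\<sigma> i < n \<longleftrightarrow> i < n"
  using assms by (auto simp: weyl_perms_def)

lemma weyl_perms_comp: "\<sigma> \<in> weyl_perms \<Longrightarrow> \<tau> \<in> weyl_perms \<Longrightarrow> \<sigma> \<circ> \<tau> \<in> weyl_perms"
  by (auto simp: weyl_perms_def permutes_compose)

lemma weyl_perms_inv: assumes "\<sigma> \<in> weyl_perms" shows "inv_into UNIV \<sigma> \<in> weyl_perms"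
proof -
  note s = weyl_permsD(1)[OF assms]
  have "inv_into UNIV \<sigma> (star r i) = star r (inv_into UNIV \<sigma> i)" if "i < n" for i
  proof -
    have "inv_into UNIV \<sigma> i < n" using that permutes_inv[OF s] by simp
    hence "\<sigma> (star r (inv_into UNIV \<sigma> i)) = star r i"
      using weyl_permsD(2)[OF assms] permutes_inverses(1)[OF s] by simp
    thus ?thesis using permutes_inv_eq[OF s] by blast
  qed
  thus ?thesis using permutes_inv[OF s] by (auto simp: weyl_perms_def)
qed

lemma mult_pat_entry:
  assumes "g \<in> carrier_mat n n" "h \<in> carrier_mat n n" "\<tau> permutes {..<n}" "pat h \<tau>" "i < n" "j < n"
  shows "(g * h) $$ (i, j) = g $$ (i, \<tau> j) * h $$ (\<tau> j, j)"
proof -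
  have "(g * h) $$ (i, j) = (\<Sum>l<n. g $$ (i, l) * h $$ (l, j))"
    using assms by (simp add: mat_mult_entry[of _ n n _ n])
  also have "\<dots> = (\<Sum>l<n. if l = \<tau> j then g $$ (i, \<tau> j) * h $$ (\<tau> j, j) else 0)"
    using assms patD[OF assms(4)] by (intro sum.cong refl) auto
  finally show ?thesis using assms by simp
qed

lemma pat_mult:
  assumes "g \<in> carrier_mat n n" "h \<in> carrier_mat n n" "\<tau> permutes {..<n}" "pat g \<sigma>" "pat h \<tau>"
  shows "pat (g * h) (\<sigma> \<circ> \<tau>)"
  using assms patD[OF assms(4)] patD[OF assms(5)]
  by (auto simp: mult_pat_entry pat_def[of _ "\<sigma> \<circ> \<tau>"])

lemma pat_unique:
  assumes "pat g \<sigma>" "pat g \<tau>" "\<sigma> permutes {..<n}" "\<tau> permutes {..<n}" shows "\<sigma> = \<tau>"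
proof
  fix j
  show "\<sigma> j = \<tau> j"
  proof (cases "j < n")
    case True thus ?thesis using assms patD[OF assms(1), of "\<sigma> j" j] patD[OF assms(2), of "\<sigma> j" j] by simp
  next
    case False thus ?thesis using assms by (simp add: permutes_def)
  qed
qed

text \<open>The columns \<open>i\<close> and \<open>star r i\<close> pair to a nonzero value, so
  their only nonzero entries must lie in paired rows.\<close>

lemma pat_weyl_perms:
  assumes g: "g \<in> carrier G" and p: "pat g \<sigma>" and s: "\<sigma> permutes {..<n}" shows "\<sigma> \<in> weyl_perms"
proof -
  have "\<sigma> (star r i) = star r (\<sigma> i)" if i: "i < n" for i
  proof -
    have "form (\<lambda>l. g $$ (l, i)) (\<lambda>l. g $$ (l, star r i)) \<noteq> 0"
      using G_col_form[OF g i] i by (simp add: gram_def)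
    then obtain l where "l < n" "g $$ (l, i) \<noteq> 0" "g $$ (star r l, star r i) \<noteq> 0"
      by (rule form_nonzeroD)
    thus ?thesis using patD[OF p] i by simp
  qed
  thus ?thesis using s by (auto simp: weyl_perms_def)
qed

lemma pat_adj:
  assumes g: "g \<in> carrier G" and p: "pat g \<sigma>" and s: "\<sigma> \<in> weyl_perms" shows "pat (adj g) (inv_into UNIV \<sigma>)"
  unfolding pat_def
proof (intro allI impI)
  fix i j assume i: "i < n" and j: "j < n"
  have "adj g $$ (i, j) \<noteq> 0 \<longleftrightarrow> star r j = star r (\<sigma> i)"
    using i j patD[OF p, of "star r j" "star r i"] weyl_permsD(2)[OF s i] by (simp add: adj_index)
  also have "\<dots> \<longleftrightarrow> \<sigma> i = j" using i j weyl_permsD(3)[OF s] star_eq_iff by auto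
  also have "\<dots> \<longleftrightarrow> i = inv_into UNIV \<sigma> j" using permutes_inv_eq[OF weyl_permsD(1)[OF s]] by metis
  finally show "adj g $$ (i, j) \<noteq> 0 \<longleftrightarrow> i = inv_into UNIV \<sigma> j" .
qed

lemma diag_torus_eq: "diag_torus r bar = {g \<in> carrier G. pat g id}"
proof -
  have "g $$ (i, i) \<noteq> 0" if g: "g \<in> carrier G" and d: "diagonal_mat g" and i: "i < n" for g i
  proof
    assume z: "g $$ (i, i) = 0"
    have "g $$ (i, j) = 0" if "j < n" for j
      using d carrier_matD[OF G_carrier_mat[OF g]] i that z by (cases "i = j") (auto simp: diagonal_mat_def)
    hence "(g * adj g) $$ (i, i) = 0"
      using g i by (simp add: mat_mult_entry[of _ n n _ n])
    thus False using adj_right[OF g] i by simp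
  qed
  thus ?thesis
    using carrier_matD[OF G_carrier_mat] unfolding diag_torus_def pat_def diagonal_mat_def id_apply
    by (intro Collect_cong conj_cong refl) (metis diagonal_mat_def)
qed

abbreviation T :: "'e mat set" where "T \<equiv> diag_torus r bar"

lemma diagonal_torus:
  assumes e: "\<And>i. i < n \<Longrightarrow> e i * bar (e (star r i)) = 1"
  shows "mat n n (\<lambda>(i, j). if i = j then e i else 0) \<in> T" (is "?t \<in> T")
proof -
  have "?t \<in> carrier G"
  proof (rule G_memI)
    fix i j assume i: "i < n" and j: "j < n"
    have "form (\<lambda>l. ?t $$ (l, i)) (\<lambda>l. ?t $$ (l, j))
        = (\<Sum>l<n. if l = i then (if j = star r i then eps r i * (e i * bar (e (star r i))) else 0) else 0)"
      unfolding form_def using i j by (intro sum.cong refl) (auto simp: star_eq_iff star_swap)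
    also have "\<dots> = gram i j" using i by (simp add: gram_def e)
    finally show "form (\<lambda>l. ?t $$ (l, i)) (\<lambda>l. ?t $$ (l, j)) = gram i j" .
  qed simp
  moreover have "pat ?t id" using e by (fastforce simp: pat_def)
  ultimately show ?thesis by (simp add: diag_torus_eq)
qed

definition weyl_coset :: "(nat \<Rightarrow> nat) \<Rightarrow> 'e mat set" where
  "weyl_coset \<sigma> = {g \<in> carrier G. pat g \<sigma>}"

text \<open>Two unitary matrices with the same pattern differ by the factor
  \<open>h * adj g\<close>, whose pattern is the identity. So a coset of the torus is determined by
  its pattern.\<close>

lemma torus_coset:
  assumes g: "g \<in> carrier G" and p: "pat g \<sigma>" and s: "\<sigma> \<in> weyl_perms"
  shows "T #>\<^bsub>G\<^esub> g = weyl_coset \<sigma>"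
proof (intro Set.set_eqI iffI)
  fix h assume "h \<in> T #>\<^bsub>G\<^esub> g"
  then obtain t where "t \<in> carrier G" "pat t id" "h = t * g" by (auto simp: r_coset_def diag_torus_eq)
  thus "h \<in> weyl_coset \<sigma>"
    using g pat_mult[of t g \<sigma> id] p weyl_permsD(1)[OF s] by (auto simp: weyl_coset_def mult_G)
next
  fix h assume "h \<in> weyl_coset \<sigma>"
  hence h: "h \<in> carrier G" "pat h \<sigma>" by (auto simp: weyl_coset_def)
  have "pat (h * adj g) (\<sigma> \<circ> inv_into UNIV \<sigma>)"
    using h pat_adj[OF g p s] permutes_inv[OF weyl_permsD(1)[OF s]] by (intro pat_mult) auto
  hence "h * adj g \<in> T"
    using h g permutes_inv_o[OF weyl_permsD(1)[OF s]] by (auto simp: diag_torus_eq mult_G adj_G)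
  moreover have "h = h * adj g * g" using h g by (simp add: cancel_right')
  ultimately show "h \<in> T #>\<^bsub>G\<^esub> g" by (auto simp: r_coset_def)
qed

lemma mem_normalizer_torus:
  "g \<in> normalizer G T \<longleftrightarrow> g \<in> carrier G \<and> (\<lambda>t. g * t * adj g) ` T = T"
proof -
  have "T \<subseteq> carrier G" by (auto simp: diag_torus_eq)
  moreover have "g <#\<^bsub>G\<^esub> T #>\<^bsub>G\<^esub> inv\<^bsub>G\<^esub> g = (\<lambda>t. g * t * adj g) ` T" if "g \<in> carrier G"
    using that by (auto simp: l_coset_def r_coset_def inv_G)
  ultimately show ?thesis by (auto simp: normalizer_def stabilizer_def)
qed

lemma pat_normalizer:
  assumes g: "g \<in> carrier G" and p: "pat g \<sigma>" and s: "\<sigma> \<in> weyl_perms"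
  shows "g \<in> normalizer G T"
proof -
  note sp = weyl_permsD(1)[OF s]
  have 1: "g * t * adj g \<in> T" if "t \<in> T" for t
  proof -
    have t: "t \<in> carrier G" "pat t id" using that by (auto simp: diag_torus_eq)
    have "pat (g * t * adj g) ((\<sigma> \<circ> id) \<circ> inv_into UNIV \<sigma>)"
      using t g p pat_adj[OF g p s] permutes_inv[OF sp] by (intro pat_mult) (auto simp: permutes_id)
    thus ?thesis using t g permutes_inv_o[OF sp] by (auto simp: diag_torus_eq mult_G adj_G)
  qed
  have 2: "adj g * t * g \<in> T" if "t \<in> T" for t
  proof -
    have t: "t \<in> carrier G" "pat t id" using that by (auto simp: diag_torus_eq)
    have "pat (adj g * t * g) ((inv_into UNIV \<sigma> \<circ> id) \<circ> \<sigma>)"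
      using t g p pat_adj[OF g p s] sp by (intro pat_mult) (auto simp: permutes_id)
    thus ?thesis using t g permutes_inv_o[OF sp] by (auto simp: diag_torus_eq mult_G adj_G)
  qed
  have "t \<in> (\<lambda>t. g * t * adj g) ` T" if "t \<in> T" for t
  proof
    have t: "t \<in> carrier G" using that by (auto simp: diag_torus_eq)
    show "t = g * (adj g * t * g) * adj g"
      using t g by (simp add: assoc_nn adj_right cancel_left')
  qed (rule 2[OF that])
  thus ?thesis using 1 g by (auto simp: mem_normalizer_torus)
qed

end

section \<open>The Weyl group as signed permutations, and its representatives in
  \<open>L_r\<close>\<close>

context valued_unitary_space
begin

lemma exists_regular_torus_element:
  obtains t where "t \<in> T" "\<And>i j. i < n \<Longrightarrow> j < n \<Longrightarrow> t $$ (i, i) = t $$ (j, j) \<Longrightarrow> i = j"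
proof -
  \<comment> \<open>The valuations are \<open>1, ..., r\<close> on the first half and their
    negatives on the second, hence distinct. The sign in \<open>- \<pi>\<close> is absorbed by
    \<open>bar\<close>, which makes the diagonal matrix unitary.\<close>
  define e where "e i = (if i < r then \<pi> ^ Suc i else inverse (- \<pi>) ^ Suc (i - r))" for i
  have v_pow: "v (x ^ k) = int k * v x" if "x \<noteq> 0" for x k
    using that by (induction k) (auto simp: v_mult algebra_simps)
  have v_inv: "v (inverse x) = - v x" if "x \<noteq> 0" for x
    using v_divide[of 1 x] that by (simp add: divide_inverse)
  have v_e: "v (e i) = (if i < r then int (Suc i) else - int (Suc (i - r)))" for i
    by (simp add: e_def v_pow v_inv v_pi del: power_Suc of_nat_Suc)
  have e_star: "e i * bar (e (star r i)) = 1" if "i < n" for i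
    using that dim by (auto simp: e_def star_def hom_power hom_inverse hom_uminus power_mult_distrib[symmetric] simp del: power_Suc)
  define t where "t = mat n n (\<lambda>(i, j). if i = j then e i else 0)"
  have "t \<in> T" unfolding t_def using e_star by (rule diagonal_torus)
  moreover have "i = j" if "i < n" "j < n" "t $$ (i, i) = t $$ (j, j)" for i j
    using arg_cong[OF that(3), of v] that(1,2) by (auto simp: t_def v_e split: if_splits)
  ultimately show thesis using that by blast
qed

text \<open>With \<open>t\<close> regular and \<open>t * g = g * s\<close>, a nonzero entry
  \<open>(i, j)\<close> of \<open>g\<close> forces \<open>t $$ (i, i) = s $$ (j, j)\<close>, so each
  column has at most one. No row or column is zero, hence the positions form a permutation.\<close>

lemma normalizer_torus_pat:
  assumes "g \<in> normalizer G T"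
  obtains \<sigma> where "\<sigma> \<in> weyl_perms" "pat g \<sigma>"
proof -
  have g: "g \<in> carrier G" and gT: "(\<lambda>t. g * t * adj g) ` T = T"
    using assms by (auto simp: mem_normalizer_torus)
  obtain t where t: "t \<in> T" and inj: "\<And>i j. i < n \<Longrightarrow> j < n \<Longrightarrow> t $$ (i, i) = t $$ (j, j) \<Longrightarrow> i = j"
    using exists_regular_torus_element by blast
  obtain s where s: "s \<in> T" and ts: "t = g * s * adj g" using t gT by blast
  have tG: "t \<in> carrier G" "pat t id" and sG: "s \<in> carrier G" "pat s id" using t s by (auto simp: diag_torus_eq)
  have eq: "t * g = g * s" using ts g sG by (simp add: cancel_right')
  have row_entry: "t $$ (i, i) * g $$ (i, j) = g $$ (i, j) * s $$ (j, j)" if "i < n" "j < n" for i j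
  proof -
    have "(t * g) $$ (i, j) = (\<Sum>l<n. if l = i then t $$ (i, i) * g $$ (i, j) else 0)"
      using that tG(1) g patD[OF tG(2)]
      by (subst mat_mult_entry[of _ n n _ n]) (simp, simp, simp, simp, intro sum.cong refl, auto)
    moreover have "(g * s) $$ (i, j) = g $$ (i, j) * s $$ (j, j)"
      using mult_pat_entry[of g s id i j] that g sG by (simp add: permutes_id)
    ultimately show ?thesis using that eq by auto
  qed
  have uniq: "i = i'" if "i < n" "i' < n" "j < n" "g $$ (i, j) \<noteq> 0" "g $$ (i', j) \<noteq> 0" for i i' j
    using row_entry[of i j] row_entry[of i' j] that inj by auto
  have ex_row: "\<exists>j<n. g $$ (i, j) \<noteq> 0" if i: "i < n" for i
  proof (rule ccontr)
    assume "\<not> ?thesis"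
    hence "(g * adj g) $$ (i, i) = 0" using g i by (simp add: mat_mult_entry[of _ n n _ n])
    thus False using adj_right[OF g] i by simp
  qed
  have ex_col: "\<exists>i<n. g $$ (i, j) \<noteq> 0" if j: "j < n" for j
  proof (rule ccontr)
    assume "\<not> ?thesis"
    hence "(adj g * g) $$ (j, j) = 0" using g j by (simp add: mat_mult_entry[of _ n n _ n])
    thus False using adj_left[OF g] j by simp
  qed
  define \<sigma> where "\<sigma> j = (if j < n then SOME i. i < n \<and> g $$ (i, j) \<noteq> 0 else j)" for j
  have \<sigma>: "\<sigma> j < n \<and> g $$ (\<sigma> j, j) \<noteq> 0" if "j < n" for j
    using someI_ex[OF ex_col[OF that, simplified conj_commute[of "_ < n"]]] that by (auto simp: \<sigma>_def conj_commute)
  have p: "pat g \<sigma>" using \<sigma> uniq by (auto simp: pat_def)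
  have "{..<n} \<subseteq> \<sigma> ` {..<n}"
  proof
    fix i assume "i \<in> {..<n}"
    then obtain j where "j < n" "g $$ (i, j) \<noteq> 0" "i < n" using ex_row by auto
    thus "i \<in> \<sigma> ` {..<n}" using uniq \<sigma> by blast
  qed
  hence "bij_betw \<sigma> {..<n} {..<n}"
    using \<sigma> finite_surj_inj[of "{..<n}" \<sigma>] by (auto simp: bij_betw_def)
  hence "\<sigma> permutes {..<n}" by (rule bij_imp_permutes) (simp add: \<sigma>_def)
  thus thesis using that pat_weyl_perms[OF g p] p by blast
qed

text \<open>The permutation matrix of \<open>\<sigma>\<close> conjugated by \<open>D\<close>, the
  diagonal matrix with entries \<open>wt i\<close>.\<close>

definition Om :: "(nat \<Rightarrow> nat) \<Rightarrow> 'e mat" where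
  "Om \<sigma> = mat n n (\<lambda>(i, j). if i = \<sigma> j then wt i / wt j else 0)"

lemma Om_carrier [simp]: "Om \<sigma> \<in> carrier_mat n n"
  and Om_index: "i < n \<Longrightarrow> j < n \<Longrightarrow> Om \<sigma> $$ (i, j) = (if i = \<sigma> j then wt i / wt j else 0)"
  by (auto simp: Om_def)

lemma pat_Om: "pat (Om \<sigma>) \<sigma>"
  by (auto simp: pat_def Om_index)

lemma Om_mult: "\<tau> \<in> weyl_perms \<Longrightarrow> Om \<sigma> * Om \<tau> = Om (\<sigma> \<circ> \<tau>)"
  by (rule eq_matI)
    (auto simp: mult_pat_entry[OF Om_carrier Om_carrier _ pat_Om] Om_index weyl_permsD(1,3) carrier_matD[OF Om_carrier])

text \<open>The product \<open>eps r k * wt k * bar (wt (star r k))\<close> equals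
  \<open>- \<pi>\<close> for every \<open>k\<close>. So conjugation by \<open>D\<close> removes the
  signs from the form up to a scalar, and what remains is invariant under permutations that commute
  with \<open>star r\<close>.\<close>

lemma Om_G: assumes s: "\<sigma> \<in> weyl_perms" shows "Om \<sigma> \<in> carrier G"
proof (rule G_memI)
  fix i j assume i: "i < n" and j: "j < n"
  have wt: "eps r k * wt k * bar (wt (star r k)) = - \<pi>" if "k < n" for k
    using that dim by (auto simp: wt_def eps_def star_def)
  have "form (\<lambda>l. Om \<sigma> $$ (l, i)) (\<lambda>l. Om \<sigma> $$ (l, j)) = (\<Sum>l<n. if l = \<sigma> i then
      (if j = star r i then eps r (\<sigma> i) * wt (\<sigma> i) * bar (wt (star r (\<sigma> i))) / (wt i * bar (wt (star r i))) else 0) else 0)"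
    unfolding form_def
  proof (intro sum.cong refl)
    fix l assume "l \<in> {..<n}"
    hence l: "l < n" by simp
    have "star r (\<sigma> i) = \<sigma> j \<longleftrightarrow> j = star r i"
      using i weyl_permsD(2)[OF s i] permutes_inj[OF weyl_permsD(1)[OF s]] by (metis injD)
    thus "eps r l * Om \<sigma> $$ (l, i) * bar (Om \<sigma> $$ (star r l, j)) = (if l = \<sigma> i then
      (if j = star r i then eps r (\<sigma> i) * wt (\<sigma> i) * bar (wt (star r (\<sigma> i))) / (wt i * bar (wt (star r i))) else 0) else 0)"
      using l i j by (auto simp: Om_index divide_inverse hom_mult hom_inverse)
  qed
  also have "\<dots> = (if j = star r i then - \<pi> / (wt i * bar (wt (star r i))) else 0)"
    using i weyl_permsD(3)[OF s] by (simp add: wt)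
  also have "\<dots> = (if j = star r i then eps r i * wt i * bar (wt (star r i)) / (wt i * bar (wt (star r i))) else 0)"
    using wt[OF i] by simp
  also have "\<dots> = gram i j" by (simp add: gram_def)
  finally show "form (\<lambda>l. Om \<sigma> $$ (l, i)) (\<lambda>l. Om \<sigma> $$ (l, j)) = gram i j" .
qed simp

lemma Om_L: "\<sigma> \<in> weyl_perms \<Longrightarrow> Om \<sigma> \<in> L_group r bar v \<pi>"
  using iw.one_R iw.zero_M iw.M_subset by (auto simp: L_group_eq Om_G Om_index)

lemma Om_weyl_coset: "\<sigma> \<in> weyl_perms \<Longrightarrow> Om \<sigma> \<in> weyl_coset \<sigma>"
  by (simp add: weyl_coset_def Om_G pat_Om)

abbreviation W :: "'e mat set monoid" where "W \<equiv> weyl_group r bar"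

lemma W_eq: "W = G\<lparr>carrier := normalizer G T\<rparr> Mod T"
  by (simp add: weyl_group_def Let_def)

text \<open>Elements of the normalizer are monomial, which bounds the quotient; the matrices
  \<open>Om \<sigma>\<close> show that every signed permutation occurs.\<close>

lemma carrier_W: "carrier W = weyl_coset ` weyl_perms"
proof (intro Set.set_eqI iffI)
  fix w assume "w \<in> carrier W"
  then obtain g where g: "g \<in> normalizer G T" "w = T #>\<^bsub>G\<^esub> g"
    by (auto simp: W_eq FactGroup_def RCOSETS_def r_coset_def)
  then obtain \<sigma> where "\<sigma> \<in> weyl_perms" "pat g \<sigma>" using normalizer_torus_pat by blast
  thus "w \<in> weyl_coset ` weyl_perms"
    using g torus_coset[of g \<sigma>] by (auto simp: mem_normalizer_torus)
next
  fix w assume "w \<in> weyl_coset ` weyl_perms"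
  then obtain \<sigma> where s: "\<sigma> \<in> weyl_perms" "w = weyl_coset \<sigma>" by blast
  have "w = T #>\<^bsub>G\<^esub> Om \<sigma>" using s torus_coset[OF Om_G pat_Om] by simp
  thus "w \<in> carrier W"
    using pat_normalizer[OF Om_G[OF s(1)] pat_Om s(1)]
    by (auto simp: W_eq FactGroup_def RCOSETS_def r_coset_def)
qed

lemma W_mult: "mult W = set_mult G"
  by (auto simp: W_eq FactGroup_def set_mult_def fun_eq_iff)

text \<open>All elements of a class share one pattern, which the description operator
  recovers.\<close>

definition Omega :: "'e mat set \<Rightarrow> 'e mat" where
  "Omega w = Om (THE \<sigma>. \<sigma> \<in> weyl_perms \<and> (\<forall>g\<in>w. pat g \<sigma>))"

lemma Omega_eqI:
  assumes "g \<in> w" "\<And>g. g \<in> w \<Longrightarrow> pat g \<sigma>" and s: "\<sigma> \<in> weyl_perms"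
  shows "Omega w = Om \<sigma>"
proof -
  have "(THE \<sigma>. \<sigma> \<in> weyl_perms \<and> (\<forall>g\<in>w. pat g \<sigma>)) = \<sigma>"
  proof (rule the_equality)
    fix \<tau> assume "\<tau> \<in> weyl_perms \<and> (\<forall>g\<in>w. pat g \<tau>)"
    thus "\<tau> = \<sigma>" using assms(1,2) pat_unique weyl_permsD(1) s by blast
  qed (use assms in blast)
  thus ?thesis by (simp add: Omega_def)
qed

lemma Omega_weyl_coset: "\<sigma> \<in> weyl_perms \<Longrightarrow> Omega (weyl_coset \<sigma>) = Om \<sigma>"
  using Om_weyl_coset by (rule Omega_eqI) (auto simp: weyl_coset_def)

text \<open>Only the pattern of \<open>g\<close> enters, so the lemma applies to the matrices
  \<open>omega_sign r\<close> and \<open>omega_swap r i\<close> without first checking that they are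
  unitary.\<close>

lemma Omega_weyl_class:
  assumes "g \<in> carrier_mat n n" "pat g \<sigma>" and s: "\<sigma> \<in> weyl_perms"
  shows "Omega (weyl_class r bar g) = Om \<sigma>"
proof (rule Omega_eqI[OF _ _ s])
  have "1\<^sub>m n \<in> T" using one_G by (auto simp: diag_torus_eq pat_def)
  thus "1\<^sub>m n * g \<in> weyl_class r bar g" by (auto simp: weyl_class_def r_coset_def)
next
  fix h assume "h \<in> weyl_class r bar g"
  then obtain t where "t \<in> carrier G" "pat t id" "h = t * g"
    by (auto simp: weyl_class_def r_coset_def diag_torus_eq)
  thus "pat h \<sigma>" using pat_mult[of t g \<sigma> id] assms weyl_permsD(1)[OF s] by auto
qed

lemma Omega_hom: "Omega \<in> hom W G"
proof (rule homI)
  fix x assume "x \<in> carrier W"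
  thus "Omega x \<in> carrier G" by (auto simp: carrier_W Omega_weyl_coset Om_G)
next
  fix x y assume "x \<in> carrier W" "y \<in> carrier W"
  then obtain \<sigma> \<tau> where s: "\<sigma> \<in> weyl_perms" "x = weyl_coset \<sigma>" and t: "\<tau> \<in> weyl_perms" "y = weyl_coset \<tau>"
    by (auto simp: carrier_W)
  have "Omega (x <#>\<^bsub>G\<^esub> y) = Om (\<sigma> \<circ> \<tau>)"
  proof (rule Omega_eqI[OF _ _ weyl_perms_comp[OF s(1) t(1)]])
    show "Om \<sigma> * Om \<tau> \<in> x <#>\<^bsub>G\<^esub> y"
      using Om_weyl_coset s t by (auto simp: set_mult_def)
  next
    fix g assume "g \<in> x <#>\<^bsub>G\<^esub> y"
    thus "pat g (\<sigma> \<circ> \<tau>)"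
      using s t weyl_permsD(1) by (auto simp: set_mult_def weyl_coset_def intro!: pat_mult)
  qed
  thus "Omega (x \<otimes>\<^bsub>W\<^esub> y) = Omega x \<otimes>\<^bsub>G\<^esub> Omega y"
    using s t by (simp add: W_mult Omega_weyl_coset Om_mult)
qed

text \<open>The sign change is the transposition of the indices 0 and \<open>r\<close>. The
  quotients of \<open>wt 0\<close> and \<open>wt r\<close> give the entries
  \<open>inverse \<pi>\<close> and \<open>\<pi>\<close>.\<close>

lemma Omega_omega_sign:
  assumes "r \<ge> 1"
  shows "Omega (weyl_class r bar (omega_sign r)) = Omega_sign r \<pi>"
proof -
  have "Transposition.transpose 0 r \<in> weyl_perms"
    unfolding weyl_perms_def using assms dim
    by (auto simp: star_def Transposition.transpose_def intro!: permutes_swap_id)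
  moreover have "pat (omega_sign r) (Transposition.transpose 0 r)"
    unfolding pat_def using assms dim by (auto simp: omega_sign_def Transposition.transpose_def)
  ultimately have "Omega (weyl_class r bar (omega_sign r)) = Om (Transposition.transpose 0 r)"
    by (intro Omega_weyl_class) (auto simp: omega_sign_def two_r)
  also have "\<dots> = Omega_sign r \<pi>"
    using assms by (intro eq_matI)
      (auto simp: Om_def Omega_sign_def two_r wt_def Transposition.transpose_def divide_inverse)
  finally show ?thesis .
qed

lemma Omega_omega_swap:
  assumes "1 \<le> i" "i < r"
  shows "Omega (weyl_class r bar (omega_swap r i)) = omega_swap r i"
proof -
  define \<sigma> where "\<sigma> = Transposition.transpose (i - 1) i \<circ> Transposition.transpose (r + i - 1) (r + i)"
  obtain j where j: "i = Suc j" using assms by (cases i) auto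
  have \<sigma>: "\<sigma> k = (if k = j then Suc j else if k = Suc j then j else
      if k = r + j then r + Suc j else if k = r + Suc j then r + j else k)" for k
    using assms by (simp add: \<sigma>_def j Transposition.transpose_def)
  have "\<sigma> permutes {..<n}"
    unfolding \<sigma>_def using assms dim by (intro permutes_compose permutes_swap_id) auto
  moreover have "\<sigma> (star r k) = star r (\<sigma> k)" if "k < n" for k
  proof (cases "k < r")
    case True thus ?thesis using assms j by (simp add: \<sigma> star_def)
  next
    case False
    then obtain k' where k': "k = r + k'" using le_Suc_ex by (metis not_less)
    thus ?thesis using assms j that dim by (simp add: \<sigma> star_def)
  qed
  ultimately have s: "\<sigma> \<in> weyl_perms" by (auto simp: weyl_perms_def)
  have "Omega (weyl_class r bar (omega_swap r i)) = Om \<sigma>"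
    by (rule Omega_weyl_class[OF _ _ s]) (auto simp: omega_swap_def two_r \<sigma>_def pat_def)
  also have "Om \<sigma> = omega_swap r i"
  proof (rule eq_matI)
    fix k l assume "k < dim_row (omega_swap r i :: 'e mat)" "l < dim_col (omega_swap r i :: 'e mat)"
    hence kl: "k < n" "l < n" by (auto simp: omega_swap_def two_r)
    \<comment> \<open>The swap preserves both halves of the basis, so conjugation by
      \<open>D\<close> leaves its permutation matrix unchanged.\<close>
    have "wt (\<sigma> l) = wt l"
      using assms j by (simp add: wt_def \<sigma>)
    thus "Om \<sigma> $$ (k, l) = omega_swap r i $$ (k, l)"
      using kl by (simp add: Om_index omega_swap_def two_r \<sigma>_def)
  qed (auto simp: Om_def omega_swap_def two_r)
  finally show ?thesis .
qed

end

section \<open>Unipotent elements of \<open>P_r\<close>, and the intersection with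
  \<open>L_r\<close>\<close>

section \<open>The unipotent radical\<close>

context unitary_space
begin

definition upper :: "'e mat \<Rightarrow> bool" where
  "upper A \<longleftrightarrow> (\<forall>i<n. \<forall>j<n. rank r j < rank r i \<longrightarrow> A $$ (i, j) = 0)"

lemma upper_mult:
  assumes A: "A \<in> carrier_mat n n" "upper A" and B: "B \<in> carrier_mat n n" "upper B"
  shows "upper (A * B)" and "i < n \<Longrightarrow> (A * B) $$ (i, i) = A $$ (i, i) * B $$ (i, i)"
proof -
  have zero: "A $$ (i, l) * B $$ (l, j) = 0" if "i < n" "j < n" "l < n" "rank r l < rank r i \<or> rank r j < rank r l" for i j l
    using that A B by (auto simp: upper_def)
  show "upper (A * B)"
    unfolding upper_def
  proof (intro allI impI)
    fix i j assume "i < n" "j < n" "rank r j < rank r i"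
    moreover from this have "A $$ (i, l) * B $$ (l, j) = 0" if "l < n" for l
      using that by (intro zero) auto
    ultimately show "(A * B) $$ (i, j) = 0"
      by (subst mat_mult_entry[OF A(1) B(1)]) (auto intro!: sum.neutral)
  qed
  assume i: "i < n"
  have "(A * B) $$ (i, i) = (\<Sum>l<n. if l = i then A $$ (i, i) * B $$ (i, i) else 0)"
    unfolding mat_mult_entry[OF A(1) B(1) i i]
  proof (intro sum.cong refl)
    fix l assume "l \<in> {..<n}"
    hence "l = i \<or> rank r l < rank r i \<or> rank r i < rank r l"
      using rank_inj[of l i] i by (metis lessThan_iff nat_neq_iff)
    thus "A $$ (i, l) * B $$ (l, i) = (if l = i then A $$ (i, i) * B $$ (i, i) else 0)"
      using zero[of i i l] i \<open>l \<in> {..<n}\<close> by auto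
  qed
  thus "(A * B) $$ (i, i) = A $$ (i, i) * B $$ (i, i)" using i by simp
qed

lemma upper_pow:
  assumes A: "A \<in> carrier_mat n n" "upper A"
  shows "upper (A ^\<^sub>m k) \<and> (\<forall>i<n. (A ^\<^sub>m k) $$ (i, i) = A $$ (i, i) ^ k)"
proof (induction k)
  case 0
  have "dim_row A = n" using A by auto
  thus ?case by (auto simp: upper_def)
next
  case (Suc k)
  thus ?case using upper_mult[OF pow_carrier_mat[OF A(1)] _ A] by auto
qed

text \<open>Each factor raises the rank by at least one. As ranks are below \<open>n\<close>, the
  \<open>n\<close>-th power vanishes.\<close>

lemma strictly_upper_pow:
  assumes A: "A \<in> carrier_mat n n" and up: "\<And>i j. i < n \<Longrightarrow> j < n \<Longrightarrow> A $$ (i, j) \<noteq> 0 \<Longrightarrow> rank r i < rank r j"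
  shows "i < n \<Longrightarrow> j < n \<Longrightarrow> (A ^\<^sub>m k) $$ (i, j) \<noteq> 0 \<Longrightarrow> rank r i + k \<le> rank r j"
proof (induction k arbitrary: j)
  case 0
  have "dim_row A = n" using A by auto
  thus ?case using 0 by (auto split: if_splits)
next
  case (Suc k)
  have "(\<Sum>l<n. (A ^\<^sub>m k) $$ (i, l) * A $$ (l, j)) \<noteq> 0"
    using Suc.prems by (simp add: mat_mult_entry[OF pow_carrier_mat[OF A] A])
  then obtain l where "l < n" "(A ^\<^sub>m k) $$ (i, l) * A $$ (l, j) \<noteq> 0"
    by (meson lessThan_iff sum.neutral)
  thus ?case using Suc.IH[of l] Suc.prems up[of l j] by fastforce
qed

abbreviation P :: "'e mat set" where "P \<equiv> borel_subgroup r bar"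

lemma P_D: "g \<in> P \<Longrightarrow> g \<in> carrier G" "g \<in> P \<Longrightarrow> upper g"
  by (auto simp: borel_subgroup_eq upper_def dest: borel.triD)

lemma P_I: "g \<in> carrier G \<Longrightarrow> upper g \<Longrightarrow> g \<in> P"
  by (auto simp: borel_subgroup_eq upper_def borel.tri_def)

lemma P_subgroup: "subgroup P G"
  using borel.tri_subgroup by (simp add: borel_subgroup_eq)

lemma P_diag_mult: "g \<in> P \<Longrightarrow> h \<in> P \<Longrightarrow> i < n \<Longrightarrow> (g * h) $$ (i, i) = g $$ (i, i) * h $$ (i, i)"
  using upper_mult(2) P_D by auto

lemma P_adj: "g \<in> P \<Longrightarrow> adj g \<in> P" and P_mult: "g \<in> P \<Longrightarrow> h \<in> P \<Longrightarrow> g * h \<in> P"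
  by (simp_all add: borel_subgroup_eq borel.tri_adj borel.tri_mult)

lemma P_diag_adj: assumes "g \<in> P" "i < n" shows "g $$ (i, i) * adj g $$ (i, i) = 1"
  using P_diag_mult[OF assms(1) P_adj[OF assms(1)] assms(2)] adj_right[OF P_D(1)[OF assms(1)]] assms(2)
  by simp

text \<open>The diagonal of a power of \<open>g - 1\<^sub>m n\<close> consists of powers of its
  diagonal entries, so nilpotency forces these to be zero. Conversely \<open>g - 1\<^sub>m n\<close>
  is then strictly triangular.\<close>

lemma unipotent_iff:
  assumes g: "g \<in> P"
  shows "unipotent_mat g \<longleftrightarrow> (\<forall>i<n. g $$ (i, i) = 1)"
proof -
  have gc: "g \<in> carrier_mat n n" using P_D(1)[OF g] by simp
  define A where "A = g - 1\<^sub>m n"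
  have A: "A \<in> carrier_mat n n" "\<And>i j. i < n \<Longrightarrow> j < n \<Longrightarrow> A $$ (i, j) = g $$ (i, j) - (if i = j then 1 else 0)"
    using gc by (auto simp: A_def minus_carrier_mat)
  have up: "upper A" using P_D(2)[OF g] by (auto simp: upper_def A)
  have uni: "unipotent_mat g \<longleftrightarrow> (\<exists>k. A ^\<^sub>m k = 0\<^sub>m n n)"
    using gc by (auto simp: unipotent_mat_def A_def square_mat.simps)
  show ?thesis
  proof
    assume "unipotent_mat g"
    then obtain k where k: "A ^\<^sub>m k = 0\<^sub>m n n" using uni by auto
    have "A $$ (i, i) ^ k = 0" if "i < n" for i
      using upper_pow[OF A(1) up, of k] that by (simp add: k)
    thus "\<forall>i<n. g $$ (i, i) = 1" by (auto simp: A)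
  next
    assume one: "\<forall>i<n. g $$ (i, i) = 1"
    have strict: "rank r i < rank r j" if ij: "i < n" "j < n" and nz: "A $$ (i, j) \<noteq> 0" for i j
    proof -
      have "i \<noteq> j" using one nz ij by (auto simp: A(2))
      hence "rank r i \<noteq> rank r j" using rank_inj ij by blast
      moreover have "\<not> rank r j < rank r i" using up nz ij by (auto simp: upper_def)
      ultimately show ?thesis by simp
    qed
    have "A ^\<^sub>m n = 0\<^sub>m n n"
    proof (rule eq_matI)
      fix i j assume "i < dim_row (0\<^sub>m n n :: 'e mat)" "j < dim_col (0\<^sub>m n n :: 'e mat)"
      hence i: "i < n" and j: "j < n" by auto
      have "(A ^\<^sub>m n) $$ (i, j) = 0"
        using strictly_upper_pow[OF A(1) strict i j, of n] rank_less[OF j] by auto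
      thus "(A ^\<^sub>m n) $$ (i, j) = 0\<^sub>m n n $$ (i, j)" using i j by simp
    qed (use carrier_matD[OF pow_carrier_mat[OF A(1), of n]] in \<open>simp_all only: index_zero_mat\<close>)
    thus "unipotent_mat g" using uni by blast
  qed
qed

text \<open>Members of the union lie in \<open>?U\<close> by \<open>unipotent_iff\<close>. Diagonal
  entries are multiplicative on \<open>P\<close>, which makes \<open>?U\<close> a normal subgroup
  and thus itself one of the sets in the union.\<close>

lemma borel_unipotent_eq: "borel_unipotent r bar = {g \<in> P. \<forall>i<n. g $$ (i, i) = 1}" (is "_ = ?U")
proof
  show "borel_unipotent r bar \<subseteq> ?U"
  proof
    fix u assume "u \<in> borel_unipotent r bar"
    then obtain U where U: "U \<lhd> G\<lparr>carrier := P\<rparr>" "\<forall>u\<in>U. unipotent_mat u" "u \<in> U"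
      by (auto simp: unipotent_radical_def)
    hence "u \<in> P" using normal_imp_subgroup[OF U(1)] subgroup.mem_carrier by fastforce
    thus "u \<in> ?U" using U unipotent_iff by auto
  qed
next
  interpret H: group "G\<lparr>carrier := P\<rparr>" using P_subgroup by (rule subgroup_imp_group)
  have inv: "inv\<^bsub>G\<lparr>carrier := P\<rparr>\<^esub> g = adj g" if "g \<in> P" for g
    using that P_subgroup m_inv_consistent P_D(1) inv_G by metis
  have "?U \<lhd> G\<lparr>carrier := P\<rparr>"
    unfolding H.normal_inv_iff
  proof (intro conjI ballI)
    show "subgroup ?U (G\<lparr>carrier := P\<rparr>)"
    proof (rule H.subgroupI)
      show "?U \<noteq> {}"
        using subgroup.one_closed[OF P_subgroup] by (intro ex_in_conv[THEN iffD1] exI[of _ "1\<^sub>m n"]) auto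
    next
      fix g assume g: "g \<in> ?U"
      hence "adj g $$ (i, i) = 1" if "i < n" for i using P_diag_adj[of g i] that by auto
      thus "inv\<^bsub>G\<lparr>carrier := P\<rparr>\<^esub> g \<in> ?U" using g inv P_adj by auto
    next
      fix g h assume "g \<in> ?U" "h \<in> ?U"
      thus "g \<otimes>\<^bsub>G\<lparr>carrier := P\<rparr>\<^esub> h \<in> ?U" by (auto simp: P_diag_mult P_mult)
    qed auto
  next
    fix x h assume "x \<in> carrier (G\<lparr>carrier := P\<rparr>)" and h: "h \<in> ?U"
    hence x: "x \<in> P" by simp
    have "(x * h * adj x) $$ (i, i) = 1" if "i < n" for i
      using x h that P_diag_adj[of x i] by (simp add: P_diag_mult P_mult P_adj)
    thus "x \<otimes>\<^bsub>G\<lparr>carrier := P\<rparr>\<^esub> h \<otimes>\<^bsub>G\<lparr>carrier := P\<rparr>\<^esub> inv\<^bsub>G\<lparr>carrier := P\<rparr>\<^esub> x \<in> ?U"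
      using x h by (auto simp: inv P_mult P_adj)
  qed
  moreover have "\<forall>u\<in>?U. unipotent_mat u" using unipotent_iff by auto
  ultimately show "?U \<subseteq> borel_unipotent r bar"
    unfolding unipotent_radical_def by blast
qed

lemma torus_subset_P: "T \<subseteq> P"
proof
  fix t assume "t \<in> T"
  hence t: "t \<in> carrier G" "pat t id" by (auto simp: diag_torus_eq)
  have "upper t" using patD[OF t(2)] by (fastforce simp: upper_def)
  with t(1) show "t \<in> P" by (rule P_I)
qed

end

context valued_unitary_space
begin

abbreviation L :: "'e mat set" where "L \<equiv> L_group r bar v \<pi>"

lemma L_mult: "g \<in> L \<Longrightarrow> h \<in> L \<Longrightarrow> g * h \<in> L" and L_adj: "g \<in> L \<Longrightarrow> adj g \<in> L"
  using subgroup.m_closed[OF L_subgroup, of g h] subgroup.m_inv_closed[OF L_subgroup, of g]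
    subgroup.mem_carrier[OF L_subgroup, of g] by (auto simp: inv_G)

text \<open>Split off the diagonal part \<open>t\<close> of \<open>g\<close>. It is unitary because
  corresponding diagonal entries of \<open>g\<close> and \<open>adj g\<close> are inverse, and it
  stays in \<open>L\<close> because the weights cancel on the diagonal.\<close>

lemma P_inter_L: "P \<inter> L = (T \<inter> L) <#>\<^bsub>G\<^esub> (borel_unipotent r bar \<inter> L)"
proof
  show "(T \<inter> L) <#>\<^bsub>G\<^esub> (borel_unipotent r bar \<inter> L) \<subseteq> P \<inter> L"
    using torus_subset_P by (auto simp: set_mult_def borel_unipotent_eq L_mult intro!: P_mult)
next
  show "P \<inter> L \<subseteq> (T \<inter> L) <#>\<^bsub>G\<^esub> (borel_unipotent r bar \<inter> L)"
  proof
    fix g assume "g \<in> P \<inter> L"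
    hence g: "g \<in> P" "g \<in> L" by auto
    define t where "t = mat n n (\<lambda>(i, j). if i = j then g $$ (i, i) else 0)"
    have t: "t \<in> T" unfolding t_def
    proof (rule diagonal_torus)
      fix i assume "i < n"
      thus "g $$ (i, i) * bar (g $$ (star r i, star r i)) = 1"
        using P_diag_adj[OF g(1)] by (simp add: adj_index)
    qed
    hence tG: "t \<in> carrier G" by (simp add: diag_torus_eq)
    have tP: "t \<in> P" using t torus_subset_P by auto
    have "g $$ (i, i) * wt i / wt i \<in> val_ring v" if "i < n" for i
      using g(2) that unfolding L_group_eq by blast
    hence tL: "t \<in> L"
      using tG iw.one_R iw.zero_M iw.M_subset by (auto simp: L_group_eq t_def)
    have "adj t * g \<in> P" using g tP by (intro P_mult P_adj)
    moreover have "(adj t * g) $$ (i, i) = 1" if "i < n" for i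
      using P_diag_mult[OF P_adj[OF tP] g(1) that] P_diag_adj[OF tP that] that
      by (simp add: t_def mult.commute)
    moreover have "adj t * g \<in> L" using g tL by (intro L_mult L_adj)
    moreover have "g = t * (adj t * g)" using tG P_D(1)[OF g(1)] by (simp add: cancel_left')
    ultimately show "g \<in> (T \<inter> L) <#>\<^bsub>G\<^esub> (borel_unipotent r bar \<inter> L)"
      using t tL by (auto simp: set_mult_def borel_unipotent_eq)
  qed
qed

section \<open>Disjointness of the cells\<close>

lemma double_coset_iff:
  "x \<in> (P #>\<^bsub>G\<^esub> g) <#>\<^bsub>G\<^esub> iw.tri \<longleftrightarrow> (\<exists>p\<in>P. \<exists>k\<in>iw.tri. x = p * g * k)"
  by (auto simp: set_mult_def r_coset_def)

lemma double_cosets_disjoint: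
  assumes s: "\<sigma> \<in> weyl_perms" and t: "\<tau> \<in> weyl_perms"
    and p: "p \<in> P" "p' \<in> P" and k: "k \<in> iw.tri" "k' \<in> iw.tri" and eq: "p * Om \<sigma> * k = p' * Om \<tau> * k'"
  shows "\<sigma> = \<tau>"
proof -
  note [simp] = P_D(1)[OF p(1)] P_D(1)[OF p(2)] iw.triD(1)[OF k(1)] iw.triD(1)[OF k(2)] Om_G[OF s] Om_G[OF t]
  define q \<kappa> where "q = adj p' * p" and "\<kappa> = k' * adj k"
  have q: "q \<in> P" using p by (simp add: q_def P_mult P_adj)
  have \<kappa>: "\<kappa> \<in> iw.tri" using k by (simp add: \<kappa>_def iw.tri_mult iw.tri_adj)
  have "q * Om \<sigma> = adj p' * (p * Om \<sigma> * k) * adj k"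
    by (simp add: q_def assoc_nn adj_right)
  also have "\<dots> = Om \<tau> * \<kappa>"
    by (simp add: eq \<kappa>_def assoc_nn cancel_left)
  finally have qk: "q * Om \<sigma> = Om \<tau> * \<kappa>" .
  \<comment> \<open>Compare the entries at \<open>(\<tau> j, j)\<close>. On the right it is a
    nonzero multiple of \<open>\<kappa> $$ (j, j)\<close>, on the left a multiple of
    \<open>q $$ (\<tau> j, \<sigma> j)\<close>, and \<open>q\<close> is upper triangular.\<close>
  have le: "rank r (\<tau> j) \<le> rank r (\<sigma> j)" if j: "j < n" for j
  proof -
    have tj: "\<tau> j < n" "\<sigma> j < n" using j weyl_permsD(3) s t by auto
    have "(Om \<tau> * \<kappa>) $$ (\<tau> j, j) = (\<Sum>l<n. Om \<tau> $$ (\<tau> j, l) * \<kappa> $$ (l, j))"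
      using tj j iw.triD(1)[OF \<kappa>] by (intro mat_mult_entry) auto
    also have "\<dots> = (\<Sum>l<n. if l = j then Om \<tau> $$ (\<tau> j, j) * \<kappa> $$ (j, j) else 0)"
      using tj j permutes_inj[OF weyl_permsD(1)[OF t]]
      by (intro sum.cong refl) (auto simp: Om_index inj_eq)
    also have "\<dots> \<noteq> 0"
      using tj j iw.tri_diag[OF \<kappa> j] iw.zero_M by (auto simp: Om_index)
    finally have "(q * Om \<sigma>) $$ (\<tau> j, j) \<noteq> 0" by (simp add: qk)
    hence "q $$ (\<tau> j, \<sigma> j) \<noteq> 0"
      using mult_pat_entry[of q "Om \<sigma>" \<sigma> "\<tau> j" j] tj j weyl_permsD(1)[OF s] pat_Om P_D(1)[OF q] by auto
    thus ?thesis using P_D(2)[OF q] tj by (auto simp: upper_def not_less[symmetric])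
  qed
  \<comment> \<open>Both sums run over the ranks of all indices, so the termwise inequality has to
    be an equality.\<close>
  have "(\<Sum>j<n. rank r (\<tau> j)) = (\<Sum>j<n. rank r (\<sigma> j))"
    using sum.permute[OF weyl_permsD(1)[OF s], of "rank r"] sum.permute[OF weyl_permsD(1)[OF t], of "rank r"]
    by (simp add: o_def)
  hence "rank r (\<tau> j) = rank r (\<sigma> j)" if "j < n" for j
    using sum_mono_inv[of "\<lambda>j. rank r (\<tau> j)" "{..<n}" "\<lambda>j. rank r (\<sigma> j)" j] le that by auto
  hence "\<sigma> j = \<tau> j" if "j < n" for j
    using that rank_inj[of "\<sigma> j" "\<tau> j"] weyl_permsD(3)[OF s] weyl_permsD(3)[OF t] by simp
  moreover have "\<sigma> j = \<tau> j" if "\<not> j < n" for j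
    using that weyl_permsD(1)[OF s] weyl_permsD(1)[OF t] by (simp add: permutes_def)
  ultimately show ?thesis by blast
qed

end

section \<open>Eichler transformations and the reduction of columns\<close>

section \<open>Unitary elimination\<close>

context unitary_space
begin

lemma form_add_left: "form (\<lambda>l. a l + c * b l) y = form a y + c * form b y"
  by (simp add: form_def sum.distrib sum_distrib_left algebra_simps)

lemma form_unit_left: "j < n \<Longrightarrow> form (\<lambda>l. if l = j then 1 else 0) y = eps r j * bar (y (star r j))"
  by (simp add: form_def if_distrib[of "(*) _"] if_distrib[of "\<lambda>x. x * _"] cong: if_cong)

lemma form_swap: "form x y = - bar (form y x)"
proof -
  have "bar (form y x) = (\<Sum>l<n. eps r l * bar (y l) * x (star r l))"
    by (simp add: form_def hom_sum hom_mult)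
  also have "\<dots> = (\<Sum>l<n. eps r (star r l) * bar (y (star r l)) * x (star r (star r l)))"
    by (rule sum_star[symmetric])
  also have "\<dots> = - form x y"
    unfolding form_def sum_negf[symmetric]
    by (intro sum.cong refl) (simp add: eps_star algebra_simps)
  finally show ?thesis by simp
qed

text \<open>The Eichler transformation sending \<open>e\<^sub>i\<close> to the isotropic vector \<open>x\<close>; the other columns are forced by
  unitarity once \<open>e\<close> with index \<open>star r i\<close> is fixed and the rest are moved only in its direction.\<close>

definition eichler :: "nat \<Rightarrow> (nat \<Rightarrow> 'e) \<Rightarrow> 'e mat" where
  "eichler i x = mat n n (\<lambda>(l, k). if k = i then x l else (if l = k then 1 else 0) +
     (if k = star r i then 0 else eps r k * eps r i * bar (x (star r k))) * (if l = star r i then 1 else 0))"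

lemma eichler_carrier [simp]: "eichler i x \<in> carrier_mat n n"
  by (simp add: eichler_def)

lemma eichler_index: "l < n \<Longrightarrow> k < n \<Longrightarrow> eichler i x $$ (l, k) =
    (if k = i then x l else (if l = k then 1 else 0) +
     (if k = star r i then 0 else eps r k * eps r i * bar (x (star r k))) * (if l = star r i then 1 else 0))"
  by (simp add: eichler_def)

text \<open>Write the columns other than \<open>i\<close> as \<open>e_k + c k * e_m\<close> with
  \<open>m = star r i\<close>. As \<open>e_m\<close> pairs only with \<open>e_i\<close>, their
  mutual pairings are the standard ones, and \<open>c k\<close> is chosen to correct the pairing
  with \<open>x\<close>, using \<open>x i = 1\<close>.\<close>

lemma eichler_G:
  assumes i: "i < n" and xi: "x i = 1" and xx: "form x x = 0"
  shows "eichler i x \<in> carrier G"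
proof (rule G_memI)
  define c where "c k = (if k = star r i then 0 else eps r k * eps r i * bar (x (star r k)))" for k
  define E where "E = (\<lambda>k l. eichler i x $$ (l, k))"
  have Ei: "form (E i) y = form x y" "form y (E i) = form y x" for y
    using i by (auto simp: E_def eichler_index intro!: form_cong)
  have E: "form (E k) y = eps r k * bar (y (star r k)) + c k * (- eps r i * bar (y i))" if "k < n" "k \<noteq> i" for k y
  proof -
    have "form (E k) y = form (\<lambda>l. (if l = k then 1 else 0) + c k * (if l = star r i then 1 else 0)) y"
      using that by (intro form_cong) (auto simp: E_def eichler_index c_def)
    thus ?thesis using that i by (simp add: form_add_left form_unit_left eps_star)
  qed
  have EE: "form (E j) (E k) = gram j k" if "j < n" "k < n" "j \<noteq> i" "k \<noteq> i" for j k
  proof -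
    have "E k i = 0" using that i star_neq[OF i] by (auto simp: E_def eichler_index)
    moreover have "E k (star r j) = (if k = star r j then 1 else 0)"
      using that i by (auto simp: E_def eichler_index star_eq_iff)
    ultimately show ?thesis using that by (simp add: E gram_def)
  qed
  have Ex: "form (E j) x = gram j i" if "j < n" "j \<noteq> i" for j
    using that i xi by (auto simp: E c_def gram_def star_swap eps_star algebra_simps)
  show "form (\<lambda>l. eichler i x $$ (l, j)) (\<lambda>l. eichler i x $$ (l, k)) = gram j k" if jk: "j < n" "k < n" for j k
  proof -
    have "form (E j) (E k) = gram j k"
    proof (cases "j = i")
      case True
      show ?thesis
      proof (cases "k = i")
        case True
        thus ?thesis using \<open>j = i\<close> xx star_neq[OF i] by (auto simp: Ei gram_def)
      next
        case False
        have "form x (E k) = - bar (gram k i)" using Ex[OF jk(2) False] form_swap[of x] by simp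
        also have "\<dots> = gram i k" using i jk by (auto simp: gram_def star_swap eps_star hom_uminus)
        finally show ?thesis using True by (simp add: Ei)
      qed
    next
      case False
      thus ?thesis using EE Ex jk by (cases "k = i") (auto simp: Ei)
    qed
    thus ?thesis by (simp add: E_def)
  qed
qed simp

text \<open>Lets a column of \<open>adj h * g\<close> be found by guessing it and multiplying by
  \<open>h\<close>, without computing \<open>adj h\<close>.\<close>

lemma adj_mult_column:
  assumes h: "h \<in> carrier G" and g: "g \<in> carrier G" and j: "j < n" and l: "l < n"
    and col: "\<And>m. m < n \<Longrightarrow> g $$ (m, j) = (\<Sum>k<n. h $$ (m, k) * z k)"
  shows "(adj h * g) $$ (l, j) = z l"
proof -
  have "(adj h * g) $$ (l, j) = (\<Sum>m<n. \<Sum>k<n. adj h $$ (l, m) * h $$ (m, k) * z k)"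
    using g j l by (simp add: mat_mult_entry[of _ n n _ n] col sum_distrib_left mult.assoc)
  also have "\<dots> = (\<Sum>k<n. (adj h * h) $$ (l, k) * z k)"
    using h l by (subst sum.swap) (simp add: mat_mult_entry[of _ n n _ n] sum_distrib_right)
  also have "\<dots> = (\<Sum>k<n. if k = l then z k else 0)"
    using l by (intro sum.cong refl) (auto simp: adj_left[OF h])
  finally show ?thesis using l by simp
qed

text \<open>Here \<open>f j\<close> is the row of the pivot of column \<open>j\<close>.\<close>

definition reduced :: "nat \<Rightarrow> (nat \<Rightarrow> nat) \<Rightarrow> 'e mat \<Rightarrow> bool" where
  "reduced q f g \<longleftrightarrow>
     (\<forall>j\<in>{q..<r}. f j < n \<and> g $$ (f j, j) \<noteq> 0 \<and> f j \<notin> f ` {Suc j..<r} \<and>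
        (\<forall>i<n. g $$ (i, j) \<noteq> 0 \<longrightarrow> i \<in> f ` {j..<r})) \<and>
     (\<forall>a\<in>f ` {q..<r}. star r a \<notin> f ` {q..<r})"

text \<open>The orthogonality relations form a triangular system for the values of \<open>y\<close>
  at the indices \<open>star r (f j)\<close>. It is solved from the last column downwards, the pivot
  being the only surviving coefficient.\<close>

lemma reduced_orthogonal:
  assumes red: "reduced q f g" and orth: "\<And>j. q \<le> j \<Longrightarrow> j < r \<Longrightarrow> form (\<lambda>l. g $$ (l, j)) y = 0"
  shows "q \<le> j \<Longrightarrow> j < r \<Longrightarrow> y (star r (f j)) = 0"
proof (induction "r - j" arbitrary: j rule: less_induct)
  case less
  have fj: "f j < n" "g $$ (f j, j) \<noteq> 0"
    and supp: "\<And>i. i < n \<Longrightarrow> g $$ (i, j) \<noteq> 0 \<Longrightarrow> i \<in> f ` {j..<r}"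
    using red less.prems by (auto simp: reduced_def)
  have "0 = (\<Sum>l<n. eps r l * g $$ (l, j) * bar (y (star r l)))"
    using orth less.prems by (simp add: form_def)
  also have "\<dots> = (\<Sum>l<n. if l = f j then eps r (f j) * g $$ (f j, j) * bar (y (star r (f j))) else 0)"
  proof (intro sum.cong refl)
    fix l assume "l \<in> {..<n}"
    hence l: "l < n" by simp
    have "g $$ (l, j) * bar (y (star r l)) = 0" if "l \<noteq> f j"
    proof (cases "g $$ (l, j) = 0")
      case False
      then obtain j' where j': "l = f j'" "j \<le> j'" "j' < r" using supp[OF l] by auto
      hence "j < j'" using that by (cases "j = j'") auto
      hence "y (star r l) = 0" using less.hyps[of j'] less.prems j' by auto
      thus ?thesis by simp
    qed simp
    thus "eps r l * g $$ (l, j) * bar (y (star r l)) =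
        (if l = f j then eps r (f j) * g $$ (f j, j) * bar (y (star r (f j))) else 0)"
      by (auto simp: mult.assoc)
  qed
  finally show ?case using fj by simp
qed

end

context valued_unitary_space
begin

text \<open>Apart from column \<open>i\<close>, the matrix differs from the identity only in row
  \<open>star r i\<close>, whose entries are conjugates of those of \<open>x\<close> up to sign. As
  \<open>star\<close> reverses ranks, the conditions on \<open>x\<close> also control this
  row.\<close>

lemma eichler_iwahori:
  assumes i: "i < n" and xi: "x i = 1" and xx: "form x x = 0"
    and xO: "\<And>l. l < n \<Longrightarrow> x l \<in> val_ring v"
    and xM: "\<And>l. l < n \<Longrightarrow> rank r i < rank r l \<Longrightarrow> x l \<in> max_ideal v"
  shows "eichler i x \<in> iw.tri"
proof -
  have e: "eps r l * eps r k * y \<in> val_ring v" if "y \<in> val_ring v" for y l k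
    using that iw.R_uminus by (auto simp: eps_def)
  have e': "eps r l * eps r k * y \<in> max_ideal v" if "y \<in> max_ideal v" for y l k
    using that iw.M_uminus by (auto simp: eps_def)
  note zo = iw.zero_M subsetD[OF iw.M_subset iw.zero_M] iw.one_R
  have "eichler i x $$ (l, k) \<in> val_ring v" if "l < n" "k < n" for l k
    using that xO zo by (auto simp: eichler_index intro!: iw.R_add e iw.R_bar)
  moreover have "eichler i x $$ (l, k) \<in> max_ideal v" if lk: "l < n" "k < n" "rank r k < rank r l" for l k
  proof (cases "k = i")
    case True thus ?thesis using lk xM by (auto simp: eichler_index)
  next
    case False
    have "x (star r k) \<in> max_ideal v" if "l = star r i"
      using lk that i rank_star_less_iff[of k "star r i"] rank_star_less_iff[of "star r i" k] by (intro xM) auto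
    thus ?thesis using False lk zo by (auto simp: eichler_index intro!: e' iw.M_bar)
  qed
  ultimately show ?thesis using eichler_G[OF i xi xx] by (auto simp: iw.tri_def)
qed

text \<open>An Eichler transformation clears column \<open>q\<close> outside the old pivot rows
  \<open>A\<close> and one new pivot row \<open>i\<close>, leaving the later columns
  untouched.\<close>

lemma elimination_step:
  assumes g: "g \<in> carrier G" and red: "reduced (Suc q) f g" and q: "q < r"
  shows "\<exists>h\<in>iw.tri. \<exists>f'. reduced q f' (adj h * g)"
proof -
  define A where "A = f ` {Suc q..<r}"
  define u where "u = (\<lambda>l. g $$ (l, q))"
  define y where "y = (\<lambda>l. g $$ (l, star r q))"
  have qn: "q < n" "star r q < n" using q dim by (auto simp: star_def)
  have AD: "a < n" "star r a \<notin> A" if "a \<in> A" for a using red that by (auto simp: reduced_def A_def)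
  \<comment> \<open>The columns \<open>j\<close> with \<open>q < j < r\<close> are orthogonal to the
    columns \<open>q\<close> and \<open>star r q\<close>, so both vanish in the rows paired with old
    pivots.\<close>
  have uA: "u (star r a) = 0" if "a \<in> A" for a
  proof -
    have "form (\<lambda>l. g $$ (l, j)) u = 0" if j: "Suc q \<le> j" "j < r" for j
    proof -
      have "j < n" "q \<noteq> star r j" using j dim by (auto simp: star_def)
      thus ?thesis using G_col_form[OF g _ qn(1)] by (simp add: u_def gram_def)
    qed
    thus ?thesis using reduced_orthogonal[OF red] that by (auto simp: A_def)
  qed
  have yA: "y (star r a) = 0" if "a \<in> A" for a
  proof -
    have "form (\<lambda>l. g $$ (l, j)) y = 0" if j: "Suc q \<le> j" "j < r" for j
    proof -
      have "j < n" "star r q \<noteq> star r j" using j dim by (auto simp: star_def)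
      thus ?thesis using G_col_form[OF g _ qn(2)] by (simp add: y_def gram_def)
    qed
    thus ?thesis using reduced_orthogonal[OF red] that by (auto simp: A_def)
  qed
  define S where "S = {l. l < n \<and> u l \<noteq> 0 \<and> l \<notin> A \<and> star r l \<notin> A}"
  have uS: "l \<in> A \<or> l \<in> S" if "l < n" "u l \<noteq> 0" for l
    using that uA[of "star r l"] by (auto simp: S_def)
  \<comment> \<open>The pairing of the columns \<open>q\<close> and \<open>star r q\<close>
    guarantees a nonzero entry of \<open>u\<close> in a row that can still serve as pivot.\<close>
  have "form u y \<noteq> 0"
    unfolding u_def y_def G_col_form[OF g qn] by (simp add: gram_def)
  then obtain l where l: "l < n" "u l \<noteq> 0" "y (star r l) \<noteq> 0"
    by (rule form_nonzeroD)
  hence "l \<notin> A" using yA by auto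
  hence "S \<noteq> {}" using uS l by auto
  moreover have "finite S" by (simp add: S_def)
  \<comment> \<open>Ranks are smaller than \<open>n\<close>, so this single integer compares
    valuations first and, when they agree, prefers the larger rank.\<close>
  ultimately obtain i where "is_arg_min (\<lambda>l. v (u l) * int n - int (rank r l)) (\<lambda>l. l \<in> S) i"
    using ex_is_arg_min_if_finite[of S "\<lambda>l. v (u l) * int n - int (rank r l)"] by auto
  hence iS: "i \<in> S" and min: "\<And>l. l \<in> S \<Longrightarrow> v (u i) * int n - int (rank r i) \<le> v (u l) * int n - int (rank r l)"
    by (auto simp: is_arg_min_linorder)
  have i: "i < n" "u i \<noteq> 0" "i \<notin> A" "star r i \<notin> A" using iS by (auto simp: S_def)
  define x where "x l = (if l \<in> S then u l / u i else 0)" for l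
  have xi: "x i = 1" using iS i by (simp add: x_def)
  have xA: "x a = 0" "x (star r a) = 0" if "a \<in> A" for a using that AD by (auto simp: x_def S_def)
  have xu: "x l * u i = u l" if "l < n" "l \<notin> A" for l using uS[of l] that i by (auto simp: x_def)
  \<comment> \<open>The rows in \<open>A\<close> and their partners contribute nothing to the
    isotropy of \<open>u\<close>, and on the other rows \<open>u\<close> is \<open>u i\<close> times
    \<open>x\<close>.\<close>
  have xx: "form x x = 0"
  proof -
    have "form u u = (\<Sum>l<n. u i * bar (u i) * (eps r l * x l * bar (x (star r l))))"
      unfolding form_def
    proof (intro sum.cong refl)
      fix l assume "l \<in> {..<n}"
      hence l: "l < n" by simp
      consider "l \<in> A" | "star r l \<in> A" | "l \<notin> A" "star r l \<notin> A" by blast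
      thus "eps r l * u l * bar (u (star r l)) = u i * bar (u i) * (eps r l * x l * bar (x (star r l)))"
      proof cases
        case 1 thus ?thesis using uA xA by simp
      next
        case 2 thus ?thesis using uA[of "star r l"] xA[of "star r l"] l by simp
      next
        case 3
        thus ?thesis using xu[of l, symmetric] xu[of "star r l", symmetric] l by (simp add: hom_mult)
      qed
    qed
    also have "\<dots> = u i * bar (u i) * form x x" by (simp add: form_def sum_distrib_left)
    finally have "u i * bar (u i) * form x x = form u u" ..
    also have "\<dots> = 0" unfolding u_def G_col_form[OF g qn(1) qn(1)] using star_neq[OF qn(1)] by (simp add: gram_def)
    finally show ?thesis using i by simp
  qed
  have val: "v (u i) \<le> v (u l)" "rank r i < rank r l \<Longrightarrow> v (u i) < v (u l)" if "l \<in> S" for l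
  proof -
    have l: "l < n" using that by (simp add: S_def)
    have pos: "0 < int n" using l by simp
    show "v (u i) \<le> v (u l)"
    proof (rule ccontr)
      assume "\<not> ?thesis"
      hence "(v (u l) + 1) * int n \<le> v (u i) * int n" using pos by (intro mult_right_mono) auto
      thus False using min[OF that] rank_less[OF i(1)] by (simp add: algebra_simps)
    qed
    show "v (u i) < v (u l)" if "rank r i < rank r l"
    proof -
      have "v (u i) * int n < v (u l) * int n" using min[OF \<open>l \<in> S\<close>] that by linarith
      thus ?thesis using pos by simp
    qed
  qed
  define h where "h = eichler i x"
  have h: "h \<in> iw.tri" unfolding h_def
  proof (rule eichler_iwahori[OF i(1) xi xx])
    show "x l \<in> val_ring v" if "l < n" for l
      using val(1)[of l] i by (auto simp: x_def val_ge_def v_divide S_def)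
    show "x l \<in> max_ideal v" if "l < n" "rank r i < rank r l" for l
      using val(2)[of l] i that by (auto simp: x_def val_ge_def v_divide S_def)
  qed
  have hG: "h \<in> carrier G" using h by (rule iw.triD)
  \<comment> \<open>The transformation fixes the basis vectors of the old pivot rows, which support
    the columns already reduced.\<close>
  have hA: "h $$ (m, a) = (if a = m then 1 else 0)" if "m < n" "a \<in> A" for m a
    using that i AD[OF that(2)] xA[OF that(2)] by (auto simp: h_def eichler_index)
  have col: "(adj h * g) $$ (l, j) = g $$ (l, j)" if l: "l < n" and j: "Suc q \<le> j" "j < r" for l j
  proof (rule adj_mult_column[OF hG g _ l])
    show "j < n" using j dim by simp
    fix m assume m: "m < n"
    have "(\<Sum>k<n. h $$ (m, k) * g $$ (k, j)) = (\<Sum>k<n. if k = m then g $$ (m, j) else 0)"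
    proof (intro sum.cong refl)
      fix k assume "k \<in> {..<n}"
      hence k: "k < n" by simp
      show "h $$ (m, k) * g $$ (k, j) = (if k = m then g $$ (m, j) else 0)"
      proof (cases "g $$ (k, j) = 0")
        case False
        hence "k \<in> f ` {j..<r}" using red j k by (auto simp: reduced_def)
        hence "k \<in> A" using j by (auto simp: A_def)
        thus ?thesis using hA m by simp
      qed auto
    qed
    thus "g $$ (m, j) = (\<Sum>k<n. h $$ (m, k) * g $$ (k, j))" using m by simp
  qed
  \<comment> \<open>The new column \<open>q\<close>: old pivot rows are kept, and everything else is
    gathered in row \<open>i\<close>.\<close>
  define z where "z k = (if k \<in> A then u k else if k = i then u i else 0)" for k
  have colq: "(adj h * g) $$ (l, q) = z l" if l: "l < n" for l
  proof (rule adj_mult_column[OF hG g qn(1) l])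
    fix m assume m: "m < n"
    have "(\<Sum>k<n. h $$ (m, k) * z k)
        = (\<Sum>k<n. (if k = m then (if m \<in> A then u m else 0) else 0) + (if k = i then x m * u i else 0))"
    proof (intro sum.cong refl)
      fix k assume "k \<in> {..<n}"
      show "h $$ (m, k) * z k = (if k = m then (if m \<in> A then u m else 0) else 0) + (if k = i then x m * u i else 0)"
      proof (cases "k \<in> A")
        case True
        hence "k \<noteq> i" using i by auto
        thus ?thesis using True hA[OF m True] by (auto simp: z_def)
      next
        case False
        thus ?thesis using m i by (auto simp: z_def h_def eichler_index)
      qed
    qed
    also have "\<dots> = (if m \<in> A then u m else 0) + x m * u i"
      using m i by (simp add: sum.distrib)
    also have "\<dots> = u m" using xA xu m by auto
    finally show "g $$ (m, q) = (\<Sum>k<n. h $$ (m, k) * z k)" by (simp add: u_def)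
  qed
  define f' where "f' = f(q := i)"
  have f'A: "f' ` {j..<r} = f ` {j..<r}" if "Suc q \<le> j" for j
    using that by (auto simp: f'_def)
  have "{q..<r} = insert q {Suc q..<r}" using q by auto
  hence "f' ` {q..<r} = insert (f' q) (f' ` {Suc q..<r})" by simp
  hence f'q: "f' ` {q..<r} = insert i A" unfolding f'A[OF order_refl] A_def by (simp add: f'_def)
  have "reduced q f' (adj h * g)"
    unfolding reduced_def
  proof (intro conjI ballI)
    fix j assume j: "j \<in> {q..<r}"
    have "f' j < n \<and> (adj h * g) $$ (f' j, j) \<noteq> 0 \<and> f' j \<notin> f' ` {Suc j..<r} \<and>
        (\<forall>l<n. (adj h * g) $$ (l, j) \<noteq> 0 \<longrightarrow> l \<in> f' ` {j..<r})"
    proof (cases "j = q")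
      case True
      have "f' q = i" by (simp add: f'_def)
      moreover have "f' ` {Suc q..<r} = A" using f'A[of "Suc q"] by (simp add: A_def)
      ultimately show ?thesis using True i colq f'q by (auto simp: z_def)
    next
      case False
      hence j': "Suc q \<le> j" "j < r" using j by auto
      moreover have "f' j = f j" using False by (simp add: f'_def)
      ultimately show ?thesis using red f'A[of j] f'A[of "Suc j"] col by (auto simp: reduced_def)
    qed
    thus "f' j < n" "(adj h * g) $$ (f' j, j) \<noteq> 0" "f' j \<notin> f' ` {Suc j..<r}"
      "\<forall>l<n. (adj h * g) $$ (l, j) \<noteq> 0 \<longrightarrow> l \<in> f' ` {j..<r}" by blast+
  next
    fix a assume "a \<in> f' ` {q..<r}"
    thus "star r a \<notin> f' ` {q..<r}"
      unfolding f'q using i AD star_neq[OF i(1)] by (auto simp: star_swap)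
  qed
  thus ?thesis using h by blast
qed

lemma elimination:
  assumes g: "g \<in> carrier G"
  shows "\<exists>h\<in>iw.tri. \<exists>g'\<in>carrier G. \<exists>f. g = h * g' \<and> reduced 0 f g'"
\<comment> \<open>Descending induction over the columns, from the vacuous \<open>reduced r\<close>
  down to \<open>reduced 0\<close>.\<close>
proof (rule inc_induct[of 0 r])
  have "reduced r undefined g" by (simp add: reduced_def)
  thus "\<exists>h\<in>iw.tri. \<exists>g'\<in>carrier G. \<exists>f. g = h * g' \<and> reduced r f g'"
    using g iw.one_tri by (intro bexI[of _ "1\<^sub>m n"] bexI[of _ g] exI[of _ undefined]) auto
next
  fix q assume q: "q < r" and "\<exists>h\<in>iw.tri. \<exists>g'\<in>carrier G. \<exists>f. g = h * g' \<and> reduced (Suc q) f g'"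
  then obtain h g' f where h: "h \<in> iw.tri" and g': "g' \<in> carrier G" "g = h * g'" "reduced (Suc q) f g'" by blast
  obtain h' f' where h': "h' \<in> iw.tri" "reduced q f' (adj h' * g')"
    using elimination_step[OF g'(1,3) q] by blast
  note [simp] = iw.triD(1)[OF h] iw.triD(1)[OF h'(1)]
  have "g = h * h' * (adj h' * g')" using g' by (simp add: assoc_nn cancel_left')
  moreover have "h * h' \<in> iw.tri" using h h' by (simp add: iw.tri_mult)
  moreover have "adj h' * g' \<in> carrier G" using g' by (simp add: mult_G adj_G)
  ultimately show "\<exists>h\<in>iw.tri. \<exists>g'\<in>carrier G. \<exists>f. g = h * g' \<and> reduced q f g'" using h'(2) by blast
qed simp

section \<open>From reduced matrices to the cell decomposition\<close>

lemma Om_id: "Om id = 1\<^sub>m n"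
  by (rule eq_matI) (auto simp: Om_def)

lemma adj_Om: assumes s: "\<sigma> \<in> weyl_perms" shows "adj (Om \<sigma>) = Om (inv_into UNIV \<sigma>)"
proof -
  have "Om (inv_into UNIV \<sigma>) * Om \<sigma> = 1\<^sub>m n"
    using Om_mult[OF s] permutes_inv_o(2)[OF weyl_permsD(1)[OF s]] by (simp add: Om_id)
  hence "Om (inv_into UNIV \<sigma>) * Om \<sigma> * adj (Om \<sigma>) = adj (Om \<sigma>)" by simp
  thus ?thesis using cancel_right[OF Om_G[OF s] Om_carrier] by simp
qed

lemma reduced_decomposition:
  assumes g: "g \<in> carrier G" and red: "reduced 0 f g"
  obtains \<sigma> p where "\<sigma> \<in> weyl_perms" "p \<in> P" "g = Om \<sigma> * p"
proof -
  have fn: "f j < n" and dist: "f j \<notin> f ` {Suc j..<r}"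
    and supp: "\<And>i. i < n \<Longrightarrow> g $$ (i, j) \<noteq> 0 \<Longrightarrow> i \<in> f ` {j..<r}" if "j < r" for j
    using red that by (auto simp: reduced_def)
  have fstar: "star r (f i) \<noteq> f j" if "i < r" "j < r" for i j
    using red that by (fastforce simp: reduced_def)
  have inj: "i = j" if "f i = f j" "i < r" "j < r" for i j
    using dist[of i] dist[of j] that by (metis atLeastLessThan_iff imageI linorder_neqE_nat Suc_leI)
  \<comment> \<open>The pivots prescribe the first half of the permutation, and commuting with
    \<open>star r\<close> forces the second. The last clause of \<open>reduced\<close> keeps the two
    images apart.\<close>
  define \<sigma> where "\<sigma> j = (if j < r then f j else if j < n then star r (f (j - r)) else j)" for j
  have \<sigma>n: "\<sigma> j < n" if "j < n" for j
  proof (cases "j < r")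
    case False
    hence "j - r < r" using that dim by simp
    thus ?thesis using False that fn by (simp add: \<sigma>_def)
  qed (simp add: \<sigma>_def fn)
  have "inj_on \<sigma> {..<n}"
  proof (rule inj_onI)
    fix i j assume ij: "i \<in> {..<n}" "j \<in> {..<n}" and eq: "\<sigma> i = \<sigma> j"
    have r: "i - r < r" if "\<not> i < r" using that ij dim by auto
    have r': "j - r < r" if "\<not> j < r" using that ij dim by auto
    show "i = j"
    proof (cases "i < r"; cases "j < r")
      assume "i < r" "j < r" thus ?thesis using eq inj by (simp add: \<sigma>_def)
    next
      assume "i < r" "\<not> j < r"
      thus ?thesis using eq ij fstar[of "j - r" i] r' by (simp add: \<sigma>_def)
    next
      assume "\<not> i < r" "j < r"
      thus ?thesis using eq ij fstar[of "i - r" j] r by (simp add: \<sigma>_def)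
    next
      assume a: "\<not> i < r" "\<not> j < r"
      hence "f (i - r) = f (j - r)" using eq ij r r' fn by (simp add: \<sigma>_def star_eq_iff)
      thus ?thesis using inj[of "i - r" "j - r"] r r' a by simp
    qed
  qed
  moreover have "\<sigma> ` {..<n} \<subseteq> {..<n}" using \<sigma>n by auto
  ultimately have "bij_betw \<sigma> {..<n} {..<n}"
    using endo_inj_surj[of "{..<n}" \<sigma>] by (simp add: bij_betw_def)
  hence perm: "\<sigma> permutes {..<n}" by (rule bij_imp_permutes) (use dim in \<open>auto simp: \<sigma>_def\<close>)
  have "\<sigma> (star r i) = star r (\<sigma> i)" if i: "i < n" for i
  proof (cases "i < r")
    case True
    hence "star r i = i + r" "i + r < n" using dim by (auto simp: star_def)
    thus ?thesis using True by (simp add: \<sigma>_def)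
  next
    case False
    hence "star r i = i - r" "i - r < r" using i dim by (auto simp: star_def)
    thus ?thesis using False i fn by (simp add: \<sigma>_def)
  qed
  hence s: "\<sigma> \<in> weyl_perms" using perm by (auto simp: weyl_perms_def)
  define p where "p = adj (Om \<sigma>) * g"
  have pG: "p \<in> carrier G" using g Om_G[OF s] by (simp add: p_def mult_G adj_G)
  have entry: "g $$ (\<sigma> i, j) \<noteq> 0" if "p $$ (i, j) \<noteq> 0" "i < n" "j < n" for i j
  proof -
    have "p $$ (i, j) = (\<Sum>l<n. if l = \<sigma> i then adj (Om \<sigma>) $$ (i, \<sigma> i) * g $$ (\<sigma> i, j) else 0)"
      unfolding p_def mat_mult_entry[OF adj_carrier G_carrier_mat[OF g] that(2,3)]
    proof (intro sum.cong refl)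
      fix l assume "l \<in> {..<n}"
      hence l: "l < n" by simp
      have "i = inv_into UNIV \<sigma> l \<longleftrightarrow> l = \<sigma> i" using permutes_inv_eq[OF perm] by metis
      hence "adj (Om \<sigma>) $$ (i, l) = 0" if "l \<noteq> \<sigma> i"
        using that patD[OF pat_adj[OF Om_G[OF s] pat_Om s] \<open>i < n\<close> l] by simp
      thus "adj (Om \<sigma>) $$ (i, l) * g $$ (l, j) = (if l = \<sigma> i then adj (Om \<sigma>) $$ (i, \<sigma> i) * g $$ (\<sigma> i, j) else 0)"
        by auto
    qed
    thus ?thesis using that \<sigma>n by auto
  qed
  \<comment> \<open>After the pivot rows are moved into place, column \<open>j\<close> is supported
    in the rows from \<open>j\<close> to \<open>r - 1\<close>, which is the shape of
    \<open>P\<close>.\<close>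
  have low: "j \<le> i \<and> i < r" if "p $$ (i, j) \<noteq> 0" "i < n" "j < r" for i j
  proof -
    have "j < n" using that dim by simp
    hence "\<sigma> i \<in> f ` {j..<r}" using supp[of j "\<sigma> i"] entry that \<sigma>n by blast
    then obtain j' where j': "\<sigma> i = \<sigma> j'" "j \<le> j'" "j' < r" by (auto simp: \<sigma>_def)
    hence "i = j'" using permutes_inj[OF perm] by (simp add: inj_eq)
    thus ?thesis using j' by simp
  qed
  have "p \<in> P"
    unfolding borel_subgroup_eq
  proof (rule borel.triI[OF pG])
    show "p $$ (i, j) \<in> {0}" if "r \<le> i" "i < n" "j < r" for i j using low[of i j] that by auto
    show "p $$ (i, j) \<in> {0}" if "i < j" "j < r" for i j using low[of i j] that dim by auto
  qed simp
  moreover have "g = Om \<sigma> * p" using g Om_G[OF s] by (simp add: p_def cancel_left')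
  ultimately show thesis using that s by blast
qed

text \<open>Elimination multiplies by Iwahori elements on the left. Applying it to the inverse of
  \<open>g\<close> and inverting puts the factors into the required order.\<close>

lemma decomposition:
  assumes g: "g \<in> carrier G"
  obtains p \<sigma> k where "p \<in> P" "\<sigma> \<in> weyl_perms" "k \<in> iw.tri" "g = p * Om \<sigma> * k"
proof -
  obtain h g' f where h: "h \<in> iw.tri" and g': "g' \<in> carrier G" "reduced 0 f g'" and eq: "adj g = h * g'"
    using elimination[OF adj_G[OF g]] by blast
  obtain \<sigma> p where s: "\<sigma> \<in> weyl_perms" and p: "p \<in> P" and eq': "g' = Om \<sigma> * p"
    using reduced_decomposition[OF g'] by blast
  note [simp] = iw.triD(1)[OF h] P_D(1)[OF p] Om_G[OF s]
  have "g = adj (adj g)" using g by (simp add: adj_adj)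
  also have "\<dots> = adj p * adj (Om \<sigma>) * adj h"
    by (simp add: eq eq' adj_mult)
  finally have "g = adj p * Om (inv_into UNIV \<sigma>) * adj h" by (simp add: adj_Om s)
  thus thesis using that P_adj[OF p] weyl_perms_inv[OF s] iw.tri_adj[OF h] by blast
qed

lemma Iwasawa_decomposition:
  "(\<forall>w \<in> carrier W. Omega w \<in> w \<and> Omega w \<in> L) \<and>
   carrier G = (\<Union>w \<in> carrier W. (P #>\<^bsub>G\<^esub> Omega w) <#>\<^bsub>G\<^esub> iwahori r bar v) \<and>
   disjoint_family_on (\<lambda>w. (P #>\<^bsub>G\<^esub> Omega w) <#>\<^bsub>G\<^esub> iwahori r bar v) (carrier W) \<and>
   carrier G = P <#>\<^bsub>G\<^esub> L"
proof (intro conjI)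
  show "\<forall>w \<in> carrier W. Omega w \<in> w \<and> Omega w \<in> L"
    by (auto simp: carrier_W Omega_weyl_coset Om_weyl_coset Om_L)
  have cell: "x \<in> (P #>\<^bsub>G\<^esub> Omega (weyl_coset \<sigma>)) <#>\<^bsub>G\<^esub> iwahori r bar v \<longleftrightarrow>
      (\<exists>p\<in>P. \<exists>k\<in>iw.tri. x = p * Om \<sigma> * k)" if "\<sigma> \<in> weyl_perms" for x \<sigma>
    using that by (simp add: iwahori_eq double_coset_iff Omega_weyl_coset)
  show "carrier G = (\<Union>w \<in> carrier W. (P #>\<^bsub>G\<^esub> Omega w) <#>\<^bsub>G\<^esub> iwahori r bar v)"
  proof
    show "carrier G \<subseteq> (\<Union>w \<in> carrier W. (P #>\<^bsub>G\<^esub> Omega w) <#>\<^bsub>G\<^esub> iwahori r bar v)"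
    proof
      fix g assume "g \<in> carrier G"
      then obtain p \<sigma> k where "p \<in> P" "\<sigma> \<in> weyl_perms" "k \<in> iw.tri" "g = p * Om \<sigma> * k"
        by (rule decomposition)
      thus "g \<in> (\<Union>w \<in> carrier W. (P #>\<^bsub>G\<^esub> Omega w) <#>\<^bsub>G\<^esub> iwahori r bar v)"
        unfolding carrier_W using cell[of \<sigma> g] by blast
    qed
    show "(\<Union>w \<in> carrier W. (P #>\<^bsub>G\<^esub> Omega w) <#>\<^bsub>G\<^esub> iwahori r bar v) \<subseteq> carrier G"
      unfolding carrier_W using P_D(1) iw.triD(1) Om_G by (auto simp: cell intro!: mult_G)
  qed
  show "disjoint_family_on (\<lambda>w. (P #>\<^bsub>G\<^esub> Omega w) <#>\<^bsub>G\<^esub> iwahori r bar v) (carrier W)"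
    unfolding disjoint_family_on_def
  proof (intro ballI impI)
    fix w w' assume "w \<in> carrier W" "w' \<in> carrier W" "w \<noteq> w'"
    then obtain \<sigma> \<tau> where st: "\<sigma> \<in> weyl_perms" "\<tau> \<in> weyl_perms" "w = weyl_coset \<sigma>" "w' = weyl_coset \<tau>" "\<sigma> \<noteq> \<tau>"
      by (auto simp: carrier_W)
    show "((P #>\<^bsub>G\<^esub> Omega w) <#>\<^bsub>G\<^esub> iwahori r bar v) \<inter> ((P #>\<^bsub>G\<^esub> Omega w') <#>\<^bsub>G\<^esub> iwahori r bar v) = {}"
    proof (rule ccontr)
      assume "\<not> ?thesis"
      then obtain x where "x \<in> (P #>\<^bsub>G\<^esub> Omega w) <#>\<^bsub>G\<^esub> iwahori r bar v" "x \<in> (P #>\<^bsub>G\<^esub> Omega w') <#>\<^bsub>G\<^esub> iwahori r bar v"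
        by blast
      then obtain p k p' k' where "p \<in> P" "k \<in> iw.tri" "x = p * Om \<sigma> * k" "p' \<in> P" "k' \<in> iw.tri" "x = p' * Om \<tau> * k'"
        unfolding st cell[OF st(1)] cell[OF st(2)] by blast
      thus False using double_cosets_disjoint[OF st(1,2), of p p' k k'] st(5) by simp
    qed
  qed
  show "carrier G = P <#>\<^bsub>G\<^esub> L"
  proof
    show "P <#>\<^bsub>G\<^esub> L \<subseteq> carrier G"
      using P_D(1) subgroup.mem_carrier[OF L_subgroup] by (auto simp: set_mult_def intro!: mult_G)
    show "carrier G \<subseteq> P <#>\<^bsub>G\<^esub> L"
    proof
      fix g assume "g \<in> carrier G"
      then obtain p \<sigma> k where d: "p \<in> P" "\<sigma> \<in> weyl_perms" "k \<in> iw.tri" "g = p * Om \<sigma> * k"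
        by (rule decomposition)
      \<comment> \<open>Both the representatives and the Iwahori subgroup lie in \<open>L\<close>,
        so each cell is contained in \<open>P\<close> times \<open>L\<close>.\<close>
      hence "Om \<sigma> * k \<in> L" using iwahori_subset_L by (intro L_mult Om_L) auto
      moreover have "g = p * (Om \<sigma> * k)" using d P_D(1)[OF d(1)] iw.triD(1)[OF d(3)] by (simp add: assoc_nn)
      ultimately show "g \<in> P <#>\<^bsub>G\<^esub> L" using d(1) by (auto simp: set_mult_def)
    qed
  qed
qed

end

section \<open>Valuation and involution on a ramified quadratic extension\<close>

section \<open>Ramified quadratic extensions\<close>

text \<open>If \<open>v x < v y\<close>, recovering \<open>x\<close> as \<open>(x + y) - y\<close>
  shows that the sum cannot have larger value than \<open>x\<close>.\<close>

lemma discrete_valuation_add: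
  assumes v: "discrete_valuation v" and "x \<noteq> 0" "y \<noteq> 0" "v x \<noteq> v y"
  shows "v (x + y) = min (v x) (v y)"
proof -
  have add: "min (v x) (v y) \<le> v (x + y)" if "x \<noteq> 0" "y \<noteq> 0" "x + y \<noteq> 0" for x y
    using v that unfolding discrete_valuation_def by blast
  have *: "v (x + y) = v x" if "x \<noteq> 0" "y \<noteq> 0" "v x < v y" for x y
  proof -
    have "x + y \<noteq> 0" using that discrete_valuation_uminus[OF v, of y] by (auto simp: add_eq_0_iff2)
    thus ?thesis
      using add[of x y] add[of "x + y" "- y"] that discrete_valuation_uminus[OF v, of y] by auto
  qed
  show ?thesis
    using *[of x y] *[of y x] assms by (auto simp: add.commute min_def)
qed

text \<open>Over \<open>F\<close> the span of 1 is the image of \<open>\<iota>\<close>, so 1 and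
  \<open>\<pi>\<close> are independent, hence a basis in dimension 2.\<close>

lemma quadratic_basis:
  assumes "quadratic_extension \<iota>" and "\<pi> \<notin> range \<iota>"
  obtains a b where "x = \<iota> a + \<iota> b * \<pi>"
proof -
  interpret \<iota>: field_hom \<iota> using assms by (simp add: quadratic_extension_def)
  interpret vector_space "\<lambda>a x. \<iota> a * x"
    by unfold_locales (auto simp: algebra_simps \<iota>.hom_add \<iota>.hom_mult)
  have dim2: "dim UNIV = 2" using assms by (simp add: quadratic_extension_def)
  obtain B where B: "independent B" "UNIV \<subseteq> span B" "card B = dim UNIV"
    using basis_exists[of UNIV] by blast
  hence "finite B" using dim2 card.infinite by fastforce
  interpret finite_dimensional_vector_space "\<lambda>a x. \<iota> a * x" B
    using B \<open>finite B\<close> by unfold_locales auto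
  have span1: "span {1} = range \<iota>" by (simp add: span_singleton)
  have "\<pi> \<noteq> 1" using assms(2) \<iota>.hom_one by (metis rangeI)
  hence "independent {\<pi>, 1}" "card {\<pi>, 1} = 2"
    using assms(2) span1 by (auto simp: independent_insert)
  hence "UNIV \<subseteq> span {\<pi>, 1}"
    using dim2 by (intro card_ge_dim_independent) auto
  hence "x \<in> span {\<pi>, 1}" by blast
  then obtain b where "x - \<iota> b * \<pi> \<in> range \<iota>" using span1 by (auto simp: span_insert)
  then obtain a where "x - \<iota> b * \<pi> = \<iota> a" by auto
  hence "x = \<iota> a + \<iota> b * \<pi>" by (simp add: algebra_simps)
  thus thesis by (rule that)
qed

text \<open>The value of a nonzero \<open>\<iota> a\<close> is a multiple of \<open>e > 1\<close>,
  so it never equals that of \<open>\<iota> b * \<pi>\<close>. The value of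
  \<open>\<iota> a + \<iota> b * \<pi>\<close> is therefore the minimum of the two, which the sign
  change made by \<open>bar\<close> does not affect.\<close>

lemma valued_unitary_space_ramified:
  assumes vE: "discrete_valuation vE"
    and quad: "quadratic_extension \<iota>" and ram: "ramified_extension \<iota> vF vE"
    and gal: "galois_involution \<iota> bar"
    and pi: "\<pi> \<noteq> 0" "vE \<pi> = 1" "\<pi>\<^sup>2 \<in> range \<iota>"
  shows "valued_unitary_space bar r (2 * r) vE \<pi>"
proof -
  interpret \<iota>: field_hom \<iota> using quad by (simp add: quadratic_extension_def)
  interpret bar: field_hom bar using gal by (simp add: galois_involution_def)
  have bar_\<iota>: "bar (\<iota> a) = \<iota> a" for a using gal by (simp add: galois_involution_def)
  obtain e where e: "e > 1" "\<And>x. x \<noteq> 0 \<Longrightarrow> vE (\<iota> x) = int e * vF x"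
    using ram by (auto simp: ramified_extension_def ramification_index_def)
  have not_one: "int e * k \<noteq> 1" for k
    using e(1) zmult_eq_1_iff[of "int e" k] by auto
  have "\<pi> \<notin> range \<iota>"
  proof
    assume "\<pi> \<in> range \<iota>"
    then obtain a where a: "\<pi> = \<iota> a" by auto
    hence "a \<noteq> 0" using pi by auto
    thus False using e(2)[of a] a pi not_one by simp
  qed
  note decomp = quadratic_basis[OF quad this]
  \<comment> \<open>As \<open>\<pi>\<^sup>2\<close> is fixed, \<open>bar \<pi>\<close> is one of its
    two square roots. Fixing \<open>\<pi>\<close> would make \<open>bar\<close> the
    identity.\<close>
  have bar_pi: "bar \<pi> = - \<pi>"
  proof -
    have "bar \<pi> * bar \<pi> = \<pi> * \<pi>"
      using pi(3) bar_\<iota> by (auto simp: power2_eq_square simp flip: bar.hom_mult)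
    moreover have "bar \<pi> \<noteq> \<pi>"
    proof
      assume b: "bar \<pi> = \<pi>"
      have "bar x = x" for x
      proof -
        obtain a c where "x = \<iota> a + \<iota> c * \<pi>" by (rule decomp)
        thus ?thesis by (simp add: bar.hom_add bar.hom_mult bar_\<iota> b)
      qed
      hence "bar = id" by auto
      thus False using gal by (simp add: galois_involution_def)
    qed
    ultimately show ?thesis using square_eq_iff by blast
  qed
  have bar_decomp: "bar (\<iota> a + \<iota> b * \<pi>) = \<iota> a - \<iota> b * \<pi>" for a b
    by (simp add: bar.hom_add bar.hom_mult bar_\<iota> bar_pi)
  have bar_bar: "bar (bar x) = x" for x
  proof -
    obtain a b where x: "x = \<iota> a + \<iota> b * \<pi>" by (rule decomp)
    show ?thesis unfolding x bar_decomp using bar_decomp[of a "- b"] by (simp add: \<iota>.hom_uminus)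
  qed
  have v_bar: "vE (bar x) = vE x" for x
  proof -
    obtain a b where x: "x = \<iota> a + \<iota> b * \<pi>" by (rule decomp)
    have neg: "vE (- y) = vE y" for y by (rule discrete_valuation_uminus[OF vE])
    show ?thesis
    proof (cases "a = 0 \<or> b = 0")
      case True
      thus ?thesis unfolding x bar_decomp using neg[of "\<iota> b * \<pi>"] by auto
    next
      case False
      have "vE (\<iota> b * \<pi>) = vE (\<iota> b) + 1"
        using vE False pi by (auto simp: discrete_valuation_def)
      hence "vE (\<iota> b * \<pi>) - vE (\<iota> a) = 1 - int e * (vF a - vF b)"
        using False e(2) by (simp add: algebra_simps)
      hence "vE (\<iota> a) \<noteq> vE (\<iota> b * \<pi>)" using not_one[of "vF a - vF b"] by auto
      thus ?thesis
        unfolding x bar_decomp using False pi neg[of "\<iota> b * \<pi>"]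
          discrete_valuation_add[OF vE, of "\<iota> a" "\<iota> b * \<pi>"] discrete_valuation_add[OF vE, of "\<iota> a" "- (\<iota> b * \<pi>)"]
        by simp
    qed
  qed
  show ?thesis
    by unfold_locales (simp_all add: bar_bar vE v_bar bar_pi pi)
qed

theorem theorem3p34:
  fixes p r :: nat
    and \<iota> :: "'f::field_char_0 \<Rightarrow> 'e::field_char_0"
    and vF :: "'f \<Rightarrow> int" and vE :: "'e \<Rightarrow> int"
    and bar :: "'e \<Rightarrow> 'e" and \<pi> :: 'e
  defines "G \<equiv> unitary_group r bar"
    and "T \<equiv> diag_torus r bar"
    and "P \<equiv> borel_subgroup r bar"
    and "N \<equiv> borel_unipotent r bar"
    and "I \<equiv> iwahori r bar vE"
    and "L \<equiv> L_group r bar vE \<pi>"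
    and "W \<equiv> weyl_group r bar"
  assumes "odd p"
    and "padic_field p vF" and "padic_field p vE"
    and "quadratic_extension \<iota>" and "ramified_extension \<iota> vF vE"
    and "galois_involution \<iota> bar"
    and "\<pi> \<noteq> 0" and "vE \<pi> = 1" and "\<pi>^2 \<in> range \<iota>"
    and "r \<ge> 1"
  shows "(\<exists>\<Omega>.
            (\<forall>w \<in> carrier W. \<Omega> w \<in> w \<and> \<Omega> w \<in> L) \<and>
            (\<forall>i. 1 \<le> i \<and> i < r \<longrightarrow> \<Omega> (weyl_class r bar (omega_swap r i)) = omega_swap r i) \<and>
            \<Omega> (weyl_class r bar (omega_sign r)) = Omega_sign r \<pi> \<and>
            \<Omega> \<in> hom W G \<and>
            carrier G = (\<Union>w \<in> carrier W. (P #>\<^bsub>G\<^esub> \<Omega> w) <#>\<^bsub>G\<^esub> I) \<and>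
            disjoint_family_on (\<lambda>w. (P #>\<^bsub>G\<^esub> \<Omega> w) <#>\<^bsub>G\<^esub> I) (carrier W)) \<and>
         carrier G = P <#>\<^bsub>G\<^esub> L \<and>
         P \<inter> L = (T \<inter> L) <#>\<^bsub>G\<^esub> (N \<inter> L)"
proof -
  interpret V: valued_unitary_space bar r "2 * r" vE \<pi>
    using assms by (intro valued_unitary_space_ramified[of vE \<iota> vF]) (auto simp: padic_field_def)
  show ?thesis
    unfolding assms(1-7)
    using V.Iwasawa_decomposition V.P_inter_L V.Omega_hom V.Omega_omega_sign V.Omega_omega_swap \<open>r \<ge> 1\<close>
    by (intro conjI exI[of _ V.Omega]) auto
qed

end
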